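(* Let $G=(V,E)$ be a finite connected graph. To each $e\in E$ associate a twice continuously differentiable spin potential $\mathcal U_e:\mathbb S\to\mathbb R$ such that $-\mathcal U_e$ is positive definite, and a real $\beta_e\ge0$; write $\beta=(\beta_e)_{e\in E}$. Let $\nu_{\beta,\star}$ be the associated height function measure. Then for each $x,y\in V$ and each $e\in E$, the function $$\beta_e\mapsto\nu_{\beta,\star}[(h_x-h_y)^2]$$ (with all other $\beta_{e'}$, $e'\ne e$, fixed) is non-decreasing.
   Context: $\mathbb S=\{z\in\mathbb C:|z|=1\}$ is identified with $\mathbb R/2\pi\mathbb Z$. A function on $\mathbb S$ is called positive definite if all its Fourier coefficients are nonnegative. The dual height function potential $\mathcal V_{\beta_e}=\mathcal V_{\beta_e,e}:\mathbb Z\to\mathbb R\cup\{+\infty\}$ of $\beta_e\mathcal U_e$ is defined by requiring that $e^{-\mathcal V_{\beta_e,e}(n)}$, $n\in\mathbb Z$, are the Fourier coefficients of $e^{-\beta_e\mathcal U_e}$, i.e. $e^{-\beta_e\mathcal U_e(\alpha)}=e^{-\mathcal V_{\beta_e,e}(0)}+\sum_{n\ge1}2e^{-\mathcal V_{\beta_e,e}(n)}\cos(n\alpha)$. $\nu_{\beta,\star}$ is the probability measure on exact integer 1-forms $\mathbf n=\mathrm dh$, $h:V\to\mathbb Z$, $\mathrm dh_{xy}=h_y-h_x$, with $\nu_{\beta,\star}(\mathbf n)\propto\exp\big(-\sum_{e\in E}\mathcal V_{\beta_e,e}(\mathbf n_e)\big)$. Equivalently, it is a measure on height functions $h:V\to\mathbb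 Z$ normalised by $h_\partial=0$ at a fixed vertex $\partial$. $\nu_{\beta,\star}[\cdot]$ denotes expectation. *)

theory Defs
  imports "HOL-Analysis.Analysis" "Graph_Theory.Digraph_Component"
begin

section \<open>Functions on the unit circle\<close>

text \<open>
  Functions on the circle are functions on the complex plane of which only the values
  on the unit circle, \<open>f (cis t)\<close> for real \<open>t\<close>, matter. The identification of the circle
  with the reals modulo \<open>2 * pi\<close> is \<open>t \<mapsto> cis t\<close>, so all functions on the circle
  are automatically \<open>2 * pi\<close>-periodic in the angle.
\<close>

definition fourier_coeff :: "(complex \<Rightarrow> real) \<Rightarrow> int \<Rightarrow> complex" where
  "fourier_coeff f n =
     integral {0..2 * pi} (\<lambda>t. complex_of_real (f (cis t)) * cis (- (of_int n * t))) / (2 * pi)"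

definition positive_definite :: "(complex \<Rightarrow> real) \<Rightarrow> bool" where
  "positive_definite f \<longleftrightarrow> (\<forall>n. fourier_coeff f n \<in> \<real>\<^sub>\<ge>\<^sub>0)"

definition C2_circle :: "(complex \<Rightarrow> real) \<Rightarrow> bool" where
  "C2_circle f \<longleftrightarrow> (\<exists>f' f''.
     (\<forall>t. ((\<lambda>s. f (cis s)) has_real_derivative f' t) (at t)) \<and>
     (\<forall>t. (f' has_real_derivative f'' t) (at t)) \<and>
     continuous_on UNIV f'')"

section \<open>Dual height function potential\<close>

definition exp_ereal :: "ereal \<Rightarrow> ennreal" where
  "exp_ereal v = (case v of ereal s \<Rightarrow> ennreal (exp s) | PInfty \<Rightarrow> \<infinity> | MInfty \<Rightarrow> 0)"

text \<open>
  The potential \<open>V\<close> for which the \<open>exp (- V n)\<close> are the Fourier coefficients of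
  \<open>exp (- b * U)\<close>; it is infinite where the coefficient vanishes. The definition is meaningful
  when these coefficients are real and nonnegative, which is the case if \<open>- U\<close>
  is positive definite and \<open>b \<ge> 0\<close>. The coefficients are then also even in \<open>n\<close>.
\<close>

definition dual_potential :: "(complex \<Rightarrow> real) \<Rightarrow> real \<Rightarrow> int \<Rightarrow> ereal" where
  "dual_potential U b n =
     (let c = Re (fourier_coeff (\<lambda>z. exp (- b * U z)) n)
      in if c = 0 then \<infinity> else ereal (- ln c))"

lemma exp_dual_potential:
  assumes "positive_definite (\<lambda>z. exp (- b * U z))"
  shows "complex_of_real (enn2real (exp_ereal (- dual_potential U b n)))
       = fourier_coeff (\<lambda>z. exp (- b * U z)) n"
proof -
  define c where "c = fourier_coeff (\<lambda>z. exp (- b * U z)) n"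
  have "c \<in> \<real>\<^sub>\<ge>\<^sub>0"
    using assms by (simp add: positive_definite_def c_def)
  then have c: "Re c \<ge> 0" "c = complex_of_real (Re c)"
    by (auto simp: complex_nonneg_Reals_iff complex_eq_iff)
  have "enn2real (exp_ereal (- dual_potential U b n)) = Re c"
    using c(1) unfolding dual_potential_def Let_def c_def[symmetric] exp_ereal_def
    by (auto simp: infinity_ereal_def simp del: MInfty_eq_minfinity PInfty_eq_infinity)
  then show ?thesis
    using c(2) unfolding c_def[symmetric] by simp
qed

section \<open>Height function measure\<close>

text \<open>
  A graph is given by a \<open>pre_digraph\<close> whose arcs are the edges, each with an arbitrary
  reference orientation from tail to head; connectedness refers to the underlying undirected
  graph. The height function weights do not depend on the orientation, because
  the dual potentials are even. Parallel edges and loops are not excluded.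
\<close>

definition grad :: "('v, 'e) pre_digraph \<Rightarrow> ('v \<Rightarrow> int) \<Rightarrow> 'e \<Rightarrow> int" where
  "grad G h e = h (head G e) - h (tail G e)"

text \<open>
  Integer height functions on the vertices, normalised to vanish at the vertex \<open>r\<close>. On a
  connected graph \<open>grad\<close> is a bijection from these to the exact integer 1-forms. Extensionality
  fixes the irrelevant values outside the vertex set.
\<close>

definition heights :: "('v, 'e) pre_digraph \<Rightarrow> 'v \<Rightarrow> ('v \<Rightarrow> int) set" where
  "heights G r = {h \<in> verts G \<rightarrow>\<^sub>E UNIV. h r = 0}"

definition height_weight ::
  "('v, 'e) pre_digraph \<Rightarrow> ('e \<Rightarrow> int \<Rightarrow> ereal) \<Rightarrow> ('v \<Rightarrow> int) \<Rightarrow> ennreal" where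
  "height_weight G V h = exp_ereal (- (\<Sum>e\<in>arcs G. V e (grad G h e)))"

definition partition_function ::
  "('v, 'e) pre_digraph \<Rightarrow> 'v \<Rightarrow> ('e \<Rightarrow> int \<Rightarrow> ereal) \<Rightarrow> ennreal" where
  "partition_function G r V = (\<integral>\<^sup>+ h. height_weight G V h \<partial>count_space (heights G r))"

definition height_measure ::
  "('v, 'e) pre_digraph \<Rightarrow> 'v \<Rightarrow> ('e \<Rightarrow> complex \<Rightarrow> real) \<Rightarrow> ('e \<Rightarrow> real)
     \<Rightarrow> ('v \<Rightarrow> int) measure" where
  "height_measure G r U \<beta> =
     (let V = (\<lambda>e. dual_potential (U e) (\<beta> e))
      in density (count_space (heights G r)) (\<lambda>h. height_weight G V h / partition_function G r V))"

end

theory Submission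
  imports Defs
begin

text \<open>
  The proof is Ginibre duplication carried out on the Fourier side. For \<open>\<beta> \<le> \<beta>'\<close>
  take independent height functions \<open>h'\<close> and \<open>h\<close> with weights at \<open>\<beta>'\<close> and \<open>\<beta>\<close>,
  and pass to \<open>s = h' + h\<close> and \<open>d = h' - h\<close>. On each edge, the joint weight is a positive
  semidefinite kernel in the gradients of \<open>s\<close> and \<open>d\<close>: in the duplicated angles it is the
  exponential of a nonnegative combination of
  \<open>cos (k \<alpha>') + cos (k \<alpha>) = 2 cos (k (\<alpha>' + \<alpha>) / 2) cos (k (\<alpha>' - \<alpha>) / 2)\<close>
  and of the characters \<open>k\<close> in \<open>\<alpha>'\<close> alone. By the Schur product theorem the product over the edges
  is positive semidefinite in \<open>(s, d)\<close>. With \<open>D h = h x - h y\<close>, the difference of observables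
  \<open>cos (2 t D h) - cos (2 t D h')\<close> equals \<open>2 sin (t D s) sin (t D d)\<close>,
  so summing it against the joint weight gives a nonnegative quadratic form, and the expectation
  of \<open>1 - cos (2 t D h)\<close> is non-decreasing in \<open>\<beta>\<close>. The limit \<open>t \<rightarrow> 0\<close> and
  Fatou's lemma give the claim for \<open>(D h)\<^sup>2\<close> without any prior control of second moments.
\<close>

section \<open>Fourier series on the circle\<close>


lemma continuous_on_sphere_of_angle:
  fixes f :: "complex \<Rightarrow> 'a::topological_space"
  assumes "continuous_on UNIV (\<lambda>t. f (cis t))"
  shows "continuous_on (sphere 0 1) f"
proof -
  \<comment> \<open>\<open>Arg\<close> jumps on the negative real axis, so the circle is covered by
    two relatively open arcs: without -1, where \<open>Arg z\<close> is a continuous angle, and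
    without 1, where \<open>pi + Arg (- z)\<close> is one.\<close>
  let ?S1 = "sphere 0 1 \<inter> - \<real>\<^sub>\<le>\<^sub>0 :: complex set"
  let ?S2 = "sphere 0 1 \<inter> uminus -` (- \<real>\<^sub>\<le>\<^sub>0) :: complex set"
  have 1: "continuous_on (?S1) f"
  proof -
    have "continuous_on (?S1) (\<lambda>z. f (cis (Arg z)))"
      by (rule continuous_on_compose2[OF assms]) (auto intro!: continuous_intros)
    moreover have "f (cis (Arg z)) = f z" if "z \<in> ?S1" for z
      using that by (subst cis_Arg) (auto simp: sgn_div_norm)
    ultimately show ?thesis by (rule continuous_on_eq)
  qed
  have 2: "continuous_on (?S2) f"
  proof -
    have "continuous_on (?S2) (\<lambda>z. f (cis (pi + Arg (- z))))"
      by (rule continuous_on_compose2[OF assms]) (auto intro!: continuous_intros)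
    moreover have "f (cis (pi + Arg (- z))) = f z" if "z \<in> ?S2" for z
    proof -
      have "cis (pi + Arg (- z)) = - cis (Arg (- z))" by (simp add: complex_eq_iff cos_add sin_add)
      also have "\<dots> = z" using that by (subst cis_Arg) (auto simp: sgn_div_norm)
      finally show ?thesis by simp
    qed
    ultimately show ?thesis by (rule continuous_on_eq)
  qed
  have op: "open (- \<real>\<^sub>\<le>\<^sub>0 :: complex set)" by (intro open_Compl closed_nonpos_Reals_complex)
  then have op': "open (uminus -` (- \<real>\<^sub>\<le>\<^sub>0 :: complex set))"
    by (intro open_vimage) (auto intro!: continuous_intros)
  have cover: "?S1 \<union> ?S2 = sphere 0 1"
    by (auto simp: complex_nonpos_Reals_iff complex_eq_iff norm_complex_def)
  have "continuous_on (?S1 \<union> ?S2) f"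
    using op op' by (intro continuous_on_Un_local_open 1 2; unfold cover) (auto intro: openin_open_Int)
  then show ?thesis unfolding cover .
qed

text \<open>
  Quantifying over all \<open>h\<close> turns multiplication by a product of polynomials into an iteration.
\<close>

lemma has_integral_zero_mult_polynomial:
  assumes "real_polynomial_function p"
    and "\<And>n::int. ((\<lambda>t. h t * cis (of_int n * t)) has_integral 0) S"
  shows "((\<lambda>t. h t * of_real (p (cis t)) * cis (of_int n * t)) has_integral 0) S"
  using assms
proof (induction p arbitrary: h n)
  case (linear f)
  \<comment> \<open>On the circle a real linear functional is a combination of \<open>cis t\<close>
    and \<open>cis (- t)\<close>; \<open>c\<close> and \<open>d\<close> are its two coefficients.
    Multiplying by it therefore only moves the frequency \<open>n\<close> to \<open>n + 1\<close>
    and \<open>n - 1\<close>.\<close>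
  define c where "c = (of_real (f 1) - \<i> * of_real (f \<i>)) / 2"
  define d where "d = (of_real (f 1) + \<i> * of_real (f \<i>)) / 2"
  have f: "f (cis t) = cos t * f 1 + sin t * f \<i>" for t
  proof -
    interpret bounded_linear f by fact
    have "cis t = cos t *\<^sub>R 1 + sin t *\<^sub>R \<i>" by (simp add: complex_eq_iff)
    then show ?thesis by (metis add scaleR real_scaleR_def)
  qed
  have "((\<lambda>t. c * (h t * cis (of_int (n + 1) * t)) + d * (h t * cis (of_int (n - 1) * t)))
      has_integral c * 0 + d * 0) S"
    by (intro has_integral_add has_integral_mult_right linear.prems)
  moreover have "c * (h t * cis (of_int (n + 1) * t)) + d * (h t * cis (of_int (n - 1) * t))
      = h t * of_real (f (cis t)) * cis (of_int n * t)" for t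
  proof -
    have 1: "cis (of_int (n + 1) * t) = cis (of_int n * t) * cis t"
      "cis (of_int (n - 1) * t) = cis (of_int n * t) * cis (- t)"
      by (simp_all add: cis_mult algebra_simps)
    have 2: "of_real (f (cis t)) = c * cis t + d * cis (- t)"
      unfolding f c_def d_def by (simp add: complex_eq_iff field_simps)
    show ?thesis unfolding 1 2 by (simp add: algebra_simps)
  qed
  ultimately show ?case by simp
next
  case (const c)
  have "((\<lambda>t. of_real c * (h t * cis (of_int n * t))) has_integral of_real c * 0) S"
    by (intro has_integral_mult_right const)
  then show ?case by (simp add: algebra_simps)
next
  case (add f g)
  have "((\<lambda>t. h t * of_real (f (cis t)) * cis (of_int n * t) + h t * of_real (g (cis t)) * cis (of_int n * t))
     has_integral 0 + 0) S"
    by (intro has_integral_add add)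
  then show ?case by (simp add: algebra_simps)
next
  case (mult f g)
  have "((\<lambda>t. (h t * of_real (f (cis t))) * of_real (g (cis t)) * cis (of_int n * t)) has_integral 0) S"
    by (intro mult)
  then show ?case by (simp add: algebra_simps)
qed

text \<open>By Stone-Weierstrass, \<open>g\<close> is uniformly within \<open>e\<close> of a real
  polynomial \<open>p\<close>, and \<open>g\<close> is orthogonal to \<open>p\<close>. Hence the
  integral of \<open>g^2\<close> equals that of \<open>g * (g - p)\<close>, which is at most a
  constant times \<open>e\<close>. A continuous function whose square has integral zero
  vanishes.\<close>

lemma fourier_unique:
  fixes g :: "complex \<Rightarrow> real"
  assumes cont: "continuous_on UNIV (\<lambda>t. g (cis t))"
    and zero: "\<And>n::int. ((\<lambda>t. complex_of_real (g (cis t)) * cis (of_int n * t)) has_integral 0) {0..2 * pi}"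
  shows "g (cis t) = 0"
proof -
  have sph: "continuous_on (sphere 0 1) g"
    by (rule continuous_on_sphere_of_angle[OF cont])
  have "bounded (g ` sphere 0 1)"
    by (intro compact_imp_bounded compact_continuous_image sph) simp
  then obtain B where B: "B > 0" "\<And>z. z \<in> sphere 0 1 \<Longrightarrow> \<bar>g z\<bar> \<le> B"
    unfolding bounded_pos by auto
  have con: "continuous_on {0..2*pi} (\<lambda>t. g (cis t))"
    using cont continuous_on_subset by blast
  have bound: "integral {0..2*pi} (\<lambda>t. (g (cis t))\<^sup>2) \<le> (B * (2 * pi)) * e" if "e > 0" for e
  proof -
    obtain p where p: "real_polynomial_function p" "\<And>z. z \<in> sphere 0 1 \<Longrightarrow> \<bar>g z - p z\<bar> < e"
      using Stone_Weierstrass_real_polynomial_function[OF _ sph \<open>e > 0\<close>] by auto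
    have "((\<lambda>t. complex_of_real (g (cis t)) * of_real (p (cis t)) * cis (of_int 0 * t)) has_integral 0) {0..2*pi}"
      by (rule has_integral_zero_mult_polynomial[OF p(1) zero])
    then have "((\<lambda>t. Re (complex_of_real (g (cis t)) * of_real (p (cis t)))) has_integral Re 0) {0..2*pi}"
      by (intro has_integral_linear[OF _ bounded_linear_Re, unfolded o_def]) simp
    then have gp: "((\<lambda>t. g (cis t) * p (cis t)) has_integral 0) {0..2*pi}"
      by simp
    have "((\<lambda>t. (g (cis t))\<^sup>2) has_integral integral {0..2*pi} (\<lambda>t. (g (cis t))\<^sup>2)) {0..2*pi}"
      by (intro integrable_integral integrable_continuous_real continuous_intros con)
    from has_integral_diff[OF this gp]
    have "((\<lambda>t. g (cis t) * (g (cis t) - p (cis t))) has_integral integral {0..2*pi} (\<lambda>t. (g (cis t))\<^sup>2)) {0..2*pi}"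
      by (simp add: power2_eq_square algebra_simps)
    from has_integral_bound_real[OF _ finite.emptyI this, of "B * e"]
    have "\<bar>integral {0..2*pi} (\<lambda>t. (g (cis t))\<^sup>2)\<bar> \<le> B * e * (2 * pi)"
      using B p(2) \<open>e > 0\<close> by (simp add: abs_mult mult_mono less_imp_le)
    then show ?thesis by (simp add: algebra_simps)
  qed
  have "integral {0..2*pi} (\<lambda>t. (g (cis t))\<^sup>2) \<le> 0"
  proof (rule field_le_epsilon)
    fix e :: real assume "e > 0"
    then show "integral {0..2*pi} (\<lambda>t. (g (cis t))\<^sup>2) \<le> 0 + e"
      using bound[of "e / (B * (2*pi))"] B(1) by simp
  qed
  moreover have "integral {0..2*pi} (\<lambda>t. (g (cis t))\<^sup>2) \<ge> 0"
    by (intro integral_nonneg integrable_continuous_real continuous_intros con) simp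
  ultimately have "integral {0..2*pi} (\<lambda>t. (g (cis t))\<^sup>2) = 0" by simp
  then have 0: "\<And>t. t \<in> {0..2*pi} \<Longrightarrow> (g (cis t))\<^sup>2 = 0"
    by (subst (asm) integral_eq_0_iff) (auto intro!: continuous_intros con)
  have "cis t = cis (Arg2pi (cis t))" "Arg2pi (cis t) \<in> {0..2*pi}"
    using Arg2pi[of "cis t"] by (auto simp: cis_conv_exp is_Arg_def)
  then show ?thesis using 0 by (metis zero_eq_power2)
qed

section \<open>Termwise integration, cosine coefficients and their decay\<close>

lemma integral_sums:
  fixes f :: "nat \<Rightarrow> real \<Rightarrow> real"
  assumes cont: "\<And>k. continuous_on {a..b} (f k)"
    and bound: "\<And>k t. \<bar>f k t\<bar> \<le> M k" and sM: "summable M"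
    and sums: "\<And>t. (\<lambda>k. f k t) sums g t"
  shows "(\<lambda>k. integral {a..b} (f k)) sums integral {a..b} g"
proof -
  have int: "f k integrable_on {a..b}" for k
    by (intro integrable_continuous_real cont)
  have "(\<lambda>n. integral {a..b} (\<lambda>t. \<Sum>k<n. f k t)) \<longlonglongrightarrow> integral {a..b} g"
  proof (rule dominated_convergence(2))
    show "(\<lambda>t. \<Sum>k<n. f k t) integrable_on {a..b}" for n
      by (intro integrable_sum int) simp
    show "(\<lambda>_. suminf M) integrable_on {a..b}" by (rule integrable_const_ivl)
    have M0: "M k \<ge> 0" for k using bound[of k 0] by linarith
    show "norm (\<Sum>k<n. f k t) \<le> suminf M" for n t
    proof -
      have "norm (\<Sum>k<n. f k t) \<le> (\<Sum>k<n. M k)"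
        by (rule order.trans[OF norm_sum]) (auto intro: sum_mono bound)
      also have "\<dots> \<le> suminf M" by (intro sum_le_suminf sM) (auto simp: M0)
      finally show ?thesis .
    qed
    show "(\<lambda>n. \<Sum>k<n. f k t) \<longlonglongrightarrow> g t" for t
      using sums[of t] by (simp add: sums_def)
  qed
  then show ?thesis by (simp add: sums_def integral_sum int)
qed

lemma integral_cos_int:
  "integral {0..2 * pi} (\<lambda>t. cos (of_int n * t)) = (if n = 0 then 2 * pi else 0)"
proof (cases "n = 0")
  case False
  have "((\<lambda>t. cos (of_int n * t)) has_integral
      sin (of_int n * (2*pi)) / of_int n - sin (of_int n * 0) / of_int n) {0..2*pi}"
    using False
    by (intro fundamental_theorem_of_calculus)
       (auto intro!: derivative_eq_intros simp flip: has_real_derivative_iff_has_vector_derivative)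
  then show ?thesis
    using False sin_int_2pin[of n] by (auto simp: integral_unique mult.commute)
qed simp

lemma integral_sin_int: "integral {0..2 * pi} (\<lambda>t. sin (of_int n * t)) = 0"
proof (cases "n = 0")
  case False
  have "((\<lambda>t. sin (of_int n * t)) has_integral
      (- cos (of_int n * (2*pi)) / of_int n) - (- cos (of_int n * 0) / of_int n)) {0..2*pi}"
    using False
    by (intro fundamental_theorem_of_calculus)
       (auto intro!: derivative_eq_intros simp flip: has_real_derivative_iff_has_vector_derivative)
  then show ?thesis
    using False cos_int_2pin[of n] by (auto simp: integral_unique mult.commute)
qed simp

text \<open>The argument is a function of the angle, so that powers and exponentials of a cosine
  series can be inserted directly. For functions on the circle this is the real part of the Fourier
  coefficient, which is all that \<open>dual_potential\<close> looks at.\<close>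

definition cos_coeff :: "(real \<Rightarrow> real) \<Rightarrow> int \<Rightarrow> real" where
  "cos_coeff f n = integral {0..2 * pi} (\<lambda>t. f t * cos (of_int n * t)) / (2 * pi)"

lemma
  assumes "continuous_on {0..2 * pi} (\<lambda>t. f (cis t))"
  shows Re_fourier_coeff: "Re (fourier_coeff f n) = cos_coeff (\<lambda>t. f (cis t)) n"
    and Im_fourier_coeff: "Im (fourier_coeff f n) = - integral {0..2 * pi} (\<lambda>t. f (cis t) * sin (of_int n * t)) / (2 * pi)"
proof -
  have int: "(\<lambda>t. complex_of_real (f (cis t)) * cis (- (of_int n * t))) integrable_on {0..2*pi}"
    by (intro integrable_continuous_real continuous_intros assms)
  have "Re (fourier_coeff f n) = Re (integral {0..2 * pi} (\<lambda>t. complex_of_real (f (cis t)) * cis (- (of_int n * t)))) / (2*pi)"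
    unfolding fourier_coeff_def by (metis Re_divide_of_real of_real_mult of_real_numeral)
  then show "Re (fourier_coeff f n) = cos_coeff (\<lambda>t. f (cis t)) n"
    using integral_linear[OF int bounded_linear_Re] by (simp add: cos_coeff_def o_def)
  have "Im (fourier_coeff f n) = Im (integral {0..2 * pi} (\<lambda>t. complex_of_real (f (cis t)) * cis (- (of_int n * t)))) / (2*pi)"
    unfolding fourier_coeff_def by (metis Im_divide_of_real of_real_mult of_real_numeral)
  then show "Im (fourier_coeff f n) = - integral {0..2 * pi} (\<lambda>t. f (cis t) * sin (of_int n * t)) / (2 * pi)"
    using integral_linear[OF int bounded_linear_Im] by (simp add: o_def)
qed

text \<open>Two integrations by parts gain the factor \<open>1 / n^2\<close> and leave the second
  derivative, which is bounded on one period. This decay makes the cosine series summable.\<close>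

lemma C2_circle_cos_coeff_bound:
  assumes "C2_circle f"
  obtains B where "\<And>n. n \<noteq> 0 \<Longrightarrow> \<bar>cos_coeff (\<lambda>t. f (cis t)) n\<bar> \<le> B / (of_int n)\<^sup>2"
proof -
  define F where "F t = f (cis t)" for t
  obtain F' F'' where F: "\<And>t. (F has_real_derivative F' t) (at t)"
     "\<And>t. (F' has_real_derivative F'' t) (at t)" "continuous_on UNIV F''"
    using assms unfolding C2_circle_def F_def by blast
  have per: "F (t + 2*pi) = F t" for t
    by (metis F_def cis_mult cis_2pi mult.right_neutral)
  \<comment> \<open>The derivative inherits the period; this cancels the boundary term of
    \<open>G\<close> that contains \<open>F'\<close>, while the one with the sine vanishes at both
    ends.\<close>
  have "F' (0 + 2*pi) = F' 0"
  proof -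
    have "((\<lambda>s. F (s + 2*pi)) has_real_derivative F' (0 + 2*pi)) (at 0)"
      using F(1)[of "0 + 2*pi"] unfolding DERIV_shift[symmetric] .
    then show ?thesis unfolding per using F(1)[of 0] DERIV_unique by blast
  qed
  then have F'per: "F' (2*pi) = F' 0" by simp
  have con: "continuous_on {0..2*pi} F''" using F(3) continuous_on_subset by blast
  then have "bounded (F'' ` {0..2*pi})"
    by (intro compact_imp_bounded compact_continuous_image) auto
  then obtain B where B: "B > 0" "\<And>t. t \<in> {0..2*pi} \<Longrightarrow> \<bar>F'' t\<bar> \<le> B"
    unfolding bounded_pos by auto
  have "\<bar>cos_coeff F n\<bar> \<le> B / (of_int n)\<^sup>2" if n: "n \<noteq> 0" for n
  proof -
    \<comment> \<open>antiderivative from integrating \<open>F t * cos (n t)\<close> by parts twice\<close>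
    define G where "G t = F t * sin (of_int n * t) / of_int n + F' t * cos (of_int n * t) / (of_int n)\<^sup>2" for t
    have i1: "((\<lambda>t. F t * cos (of_int n * t) + F'' t * cos (of_int n * t) / (of_int n)\<^sup>2) has_integral G (2*pi) - G 0) {0..2*pi}"
    proof (intro fundamental_theorem_of_calculus)
      fix t
      have "(G has_real_derivative F t * cos (of_int n * t) + F'' t * cos (of_int n * t) / (of_int n)\<^sup>2) (at t)"
        unfolding G_def
        using n by (auto intro!: derivative_eq_intros F simp: field_simps power2_eq_square)
      then show "(G has_vector_derivative F t * cos (of_int n * t) + F'' t * cos (of_int n * t) / (of_int n)\<^sup>2) (at t within {0..2*pi})"
        by (simp add: has_real_derivative_iff_has_vector_derivative has_vector_derivative_at_within)
    qed simp
    have G0: "G (2*pi) - G 0 = 0"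
      using sin_int_2pin[of n] cos_int_2pin[of n] F'per by (simp add: G_def mult.commute)
    have i2: "((\<lambda>t. F'' t * cos (of_int n * t) / (of_int n)\<^sup>2) has_integral
        integral {0..2*pi} (\<lambda>t. F'' t * cos (of_int n * t) / (of_int n)\<^sup>2)) {0..2*pi}"
      using n by (intro integrable_integral integrable_continuous_real continuous_intros con) auto
    have "((\<lambda>t. F t * cos (of_int n * t)) has_integral
        - integral {0..2*pi} (\<lambda>t. F'' t * cos (of_int n * t) / (of_int n)\<^sup>2)) {0..2*pi}"
      using has_integral_diff[OF i1[unfolded G0] i2] by simp
    then have "cos_coeff F n = - integral {0..2*pi} (\<lambda>t. F'' t * cos (of_int n * t) / (of_int n)\<^sup>2) / (2*pi)"
      by (simp add: cos_coeff_def integral_unique)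
    moreover have pi2: "0 < 2 * pi" by simp
    moreover have "\<bar>integral {0..2*pi} (\<lambda>t. F'' t * cos (of_int n * t) / (of_int n)\<^sup>2)\<bar> \<le> B / (of_int n)\<^sup>2 * (2*pi)"
    proof -
      have "\<bar>F'' t * cos (of_int n * t) / (of_int n)\<^sup>2\<bar> \<le> B / (of_int n)\<^sup>2" if "t \<in> {0..2*pi}" for t
      proof -
        have "\<bar>F'' t\<bar> * \<bar>cos (of_int n * t)\<bar> \<le> B * 1"
          by (intro mult_mono) (use B that in auto)
        then show ?thesis by (simp add: abs_mult divide_right_mono)
      qed
      then show ?thesis using has_integral_bound_real[OF _ finite.emptyI i2, of "B / (of_int n)\<^sup>2"] B(1) by simp
    qed
    ultimately show ?thesis by (simp only: abs_divide abs_minus_cancel abs_of_pos[OF pi2] pos_divide_le_eq[OF pi2])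
  qed
  then show ?thesis using that unfolding F_def by blast
qed


section \<open>Powers and exponentials of a cosine series with nonnegative summable
  coefficients\<close>

locale cosine_series =
  fixes c :: "nat \<Rightarrow> real" and F :: "real \<Rightarrow> real"
  assumes nonneg: "c k \<ge> 0" and summable: "summable c"
    and sums: "(\<lambda>k. c k * cos (of_nat k * t)) sums F t"
begin

lemma term_bound: "\<bar>c k * cos (of_nat k * t)\<bar> \<le> c k"
  using mult_left_mono[OF abs_cos_le_one nonneg] by (simp add: abs_mult nonneg)

lemma continuous_on_sum: "continuous_on S F"
proof (rule uniform_limit_theorem)
  have "uniform_limit S (\<lambda>n t. \<Sum>k<n. c k * cos (of_nat k * t)) (\<lambda>t. \<Sum>k. c k * cos (of_nat k * t)) sequentially"
    by (rule Weierstrass_m_test[OF _ summable]) (simp only: real_norm_def term_bound)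
  then show "uniform_limit S (\<lambda>n t. \<Sum>k<n. c k * cos (of_nat k * t)) F sequentially"
    by (simp flip: sums_unique[OF sums])
qed (auto intro!: always_eventually continuous_intros)

lemma abs_sum_le: "\<bar>F t\<bar> \<le> suminf c"
proof -
  have "norm (\<Sum>k. c k * cos (of_nat k * t)) \<le> suminf c"
    by (rule norm_suminf_le) (use summable term_bound in \<open>simp_all only: real_norm_def\<close>)
  then show ?thesis using sums_unique[OF sums] by simp
qed

lemma suminf_nonneg: "suminf c \<ge> 0"
  by (intro suminf_nonneg summable nonneg)

lemma cos_coeff_power_0: "cos_coeff (\<lambda>t. F t ^ 0) n = (if n = 0 then 1 else 0)"
  using integral_cos_int[of n] by (simp add: cos_coeff_def)

text \<open>The product formula for cosines splits the frequency \<open>n\<close> into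
  \<open>n - k\<close> and \<open>n + k\<close>, each with weight \<open>c k / 2\<close>; the sum
  over \<open>k\<close> may be integrated termwise because \<open>c\<close> is summable. This
  recursion drives the nonnegativity, the bound on total mass and the Gram property of the edge
  weights.\<close>

lemma cos_coeff_power_Suc:
  "(\<lambda>k. c k / 2 * (cos_coeff (\<lambda>t. F t ^ p) (n - int k) + cos_coeff (\<lambda>t. F t ^ p) (n + int k)))
     sums cos_coeff (\<lambda>t. F t ^ Suc p) n"
proof -
  let ?f = "\<lambda>k t. F t ^ p * (c k * cos (of_nat k * t)) * cos (of_int n * t)"
  have "(\<lambda>k. integral {0..2 * pi} (?f k)) sums integral {0..2 * pi} (\<lambda>t. F t ^ p * F t * cos (of_int n * t))"
  proof (rule integral_sums)
    show "continuous_on {0..2*pi} (?f k)" for k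
      by (intro continuous_intros continuous_on_sum)
    show "\<bar>?f k t\<bar> \<le> suminf c ^ p * c k * 1" for k t
      unfolding abs_mult[of "_ * _" "cos (of_int n * t)"] abs_mult[of "F t ^ p"] power_abs
      by (intro mult_mono power_mono term_bound abs_sum_le mult_nonneg_nonneg zero_le_power suminf_nonneg nonneg) auto
    show "summable (\<lambda>k. suminf c ^ p * c k * 1)"
      by (intro summable_mult summable_mult2 summable)
    show "(\<lambda>k. ?f k t) sums (F t ^ p * F t * cos (of_int n * t))" for t
      by (intro sums_mult sums_mult2 sums)
  qed
  from sums_divide[OF this, of "2 * pi"]
  have "(\<lambda>k. integral {0..2 * pi} (?f k) / (2 * pi)) sums cos_coeff (\<lambda>t. F t ^ Suc p) n"
    by (simp add: cos_coeff_def mult_ac)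
  moreover have "integral {0..2 * pi} (?f k) / (2 * pi)
      = c k / 2 * (cos_coeff (\<lambda>t. F t ^ p) (n - int k) + cos_coeff (\<lambda>t. F t ^ p) (n + int k))" for k
  proof -
    have 1: "?f k t = c k / 2 * (F t ^ p * cos (of_int (n - int k) * t) + F t ^ p * cos (of_int (n + int k) * t))" for t
      by (simp add: algebra_simps cos_add cos_diff)
    have int: "(\<lambda>t. F t ^ p * cos (of_int m * t)) integrable_on {0..2*pi}" for m
      by (intro integrable_continuous_real continuous_intros continuous_on_sum)
    show ?thesis
      unfolding 1 integral_mult_right
      by (subst integral_add[OF int int]) (simp add: cos_coeff_def add_divide_distrib distrib_left)
  qed
  ultimately show ?thesis by simp
qed

lemma cos_coeff_power_nonneg: "cos_coeff (\<lambda>t. F t ^ p) n \<ge> 0"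
proof (induction p arbitrary: n)
  case 0
  show ?case by (simp only: cos_coeff_power_0) simp
next
  case (Suc p)
  show ?case
    by (rule sums_le[OF _ sums_zero cos_coeff_power_Suc]) (intro mult_nonneg_nonneg add_nonneg_nonneg Suc, use nonneg in auto)
qed

text \<open>In the recursion, \<open>N\<close> is replaced by its translates by \<open>k\<close> and
  \<open>- k\<close>, so the induction must range over all finite sets. Each further power of
  \<open>F\<close> costs the total mass of \<open>c\<close>. The bound is uniform in
  \<open>N\<close> and leads to finite total edge weights.\<close>

lemma sum_cos_coeff_power_le:
  assumes "finite N"
  shows "(\<Sum>n\<in>N. cos_coeff (\<lambda>t. F t ^ p) n) \<le> suminf c ^ p"
  using assms
proof (induction p arbitrary: N)
  case 0
  have "(\<Sum>n\<in>N. cos_coeff (\<lambda>t. F t ^ 0) n) = (\<Sum>n\<in>N. if n = 0 then 1 else 0)"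
    by (simp only: cos_coeff_power_0)
  then show ?case using 0 by simp
next
  case (Suc p)
  let ?A = "\<lambda>n. cos_coeff (\<lambda>t. F t ^ p) n"
  have s1: "(\<lambda>k. \<Sum>n\<in>N. c k / 2 * (?A (n - int k) + ?A (n + int k))) sums (\<Sum>n\<in>N. cos_coeff (\<lambda>t. F t ^ Suc p) n)"
    by (intro sums_sum cos_coeff_power_Suc)
  have s2: "(\<lambda>k. c k * suminf c ^ p) sums (suminf c * suminf c ^ p)"
    by (intro sums_mult2 summable_sums summable)
  have "(\<Sum>n\<in>N. c k / 2 * (?A (n - int k) + ?A (n + int k))) \<le> c k * suminf c ^ p" for k
  proof -
    have "(\<Sum>n\<in>N. ?A (n - int k)) = (\<Sum>n\<in>(\<lambda>n. n - int k) ` N. ?A n)"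
      "(\<Sum>n\<in>N. ?A (n + int k)) = (\<Sum>n\<in>(\<lambda>n. n + int k) ` N. ?A n)"
      by (simp_all add: sum.reindex inj_on_def)
    then have "(\<Sum>n\<in>N. ?A (n - int k)) \<le> suminf c ^ p" "(\<Sum>n\<in>N. ?A (n + int k)) \<le> suminf c ^ p"
      using Suc by simp_all
    then have "(\<Sum>n\<in>N. ?A (n - int k)) + (\<Sum>n\<in>N. ?A (n + int k)) \<le> 2 * suminf c ^ p" by simp
    then have "c k / 2 * ((\<Sum>n\<in>N. ?A (n - int k)) + (\<Sum>n\<in>N. ?A (n + int k))) \<le> c k / 2 * (2 * suminf c ^ p)"
      using nonneg by (intro mult_left_mono) auto
    then show ?thesis by (simp only: sum.distrib sum_distrib_left[symmetric])
  qed
  from sums_le[OF this s1 s2] show ?case by simp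
qed

lemma cos_coeff_exp_sums:
  "(\<lambda>p. b ^ p / fact p * cos_coeff (\<lambda>t. F t ^ p) n) sums cos_coeff (\<lambda>t. exp (b * F t)) n"
proof -
  let ?f = "\<lambda>p t. b ^ p / fact p * (F t ^ p * cos (of_int n * t))"
  have "(\<lambda>p. integral {0..2 * pi} (?f p)) sums integral {0..2 * pi} (\<lambda>t. exp (b * F t) * cos (of_int n * t))"
  proof (rule integral_sums)
    show "continuous_on {0..2*pi} (?f p)" for p
      by (intro continuous_intros continuous_on_sum) auto
    show "\<bar>?f p t\<bar> \<le> \<bar>b\<bar> ^ p / fact p * (suminf c ^ p * 1)" for p t
      unfolding abs_mult abs_divide power_abs abs_of_pos[OF fact_gt_zero]
      by (intro mult_mono power_mono abs_sum_le mult_nonneg_nonneg zero_le_power suminf_nonneg) auto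
    show "summable (\<lambda>p. \<bar>b\<bar> ^ p / fact p * (suminf c ^ p * 1))"
      using summable_exp[of "\<bar>b\<bar> * suminf c"] by (simp add: power_mult_distrib field_simps)
    show "(\<lambda>p. ?f p t) sums (exp (b * F t) * cos (of_int n * t))" for t
      using sums_mult2[OF exp_converges[of "b * F t"], of "cos (of_int n * t)"]
      by (simp add: power_mult_distrib field_simps)
  qed
  from sums_divide[OF this, of "2 * pi"] show ?thesis
    by (simp add: cos_coeff_def)
qed

lemma cos_coeff_exp_nonneg: "b \<ge> 0 \<Longrightarrow> cos_coeff (\<lambda>t. exp (b * F t)) n \<ge> 0"
  by (rule sums_le[OF _ sums_zero cos_coeff_exp_sums])
     (intro mult_nonneg_nonneg cos_coeff_power_nonneg divide_nonneg_pos, auto)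

lemma cos_coeff_exp_0_pos: "cos_coeff (\<lambda>t. exp (b * F t)) 0 > 0"
proof -
  have con: "continuous_on {0..2*pi} (\<lambda>t. exp (b * F t))"
    by (intro continuous_intros continuous_on_sum)
  have "integral {0..2*pi} (\<lambda>t. exp (b * F t)) \<noteq> 0"
    by (subst integral_eq_0_iff[OF con]) auto
  moreover have "integral {0..2*pi} (\<lambda>t. exp (b * F t)) \<ge> 0"
    by (intro integral_nonneg integrable_continuous_real con) auto
  ultimately show ?thesis by (simp add: cos_coeff_def)
qed

lemma sum_cos_coeff_exp_le:
  assumes "finite N" "b \<ge> 0"
  shows "(\<Sum>n\<in>N. cos_coeff (\<lambda>t. exp (b * F t)) n) \<le> exp (b * suminf c)"
proof (rule sums_le)
  show "(\<lambda>p. \<Sum>n\<in>N. b ^ p / fact p * cos_coeff (\<lambda>t. F t ^ p) n) sums (\<Sum>n\<in>N. cos_coeff (\<lambda>t. exp (b * F t)) n)"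
    by (intro sums_sum cos_coeff_exp_sums)
  show "(\<lambda>p. b ^ p / fact p * suminf c ^ p) sums exp (b * suminf c)"
    using exp_converges[of "b * suminf c"] by (simp add: power_mult_distrib field_simps)
  show "(\<Sum>n\<in>N. b ^ p / fact p * cos_coeff (\<lambda>t. F t ^ p) n) \<le> b ^ p / fact p * suminf c ^ p" for p
    using sum_cos_coeff_power_le[OF assms(1), of p] assms(2)
    unfolding sum_distrib_left[symmetric] by (intro mult_left_mono) auto
qed

end

section \<open>Cosine expansion of a positive definite C2 function\<close>

lemma cosine_series_exists:
  assumes C2: "C2_circle f" and pd: "positive_definite f"
  obtains c where "cosine_series c (\<lambda>t. f (cis t))"
proof -
  define F where "F t = f (cis t)" for t
  have F_eq: "(\<lambda>t. f (cis t)) = F" by (simp add: F_def fun_eq_iff)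
  have contF: "continuous_on S F" for S
  proof -
    obtain F' where "\<And>t. (F has_real_derivative F' t) (at t)"
      using C2 unfolding C2_circle_def F_def by blast
    then show ?thesis by (meson DERIV_isCont continuous_at_imp_continuous_on)
  qed
  \<comment> \<open>The frequencies \<open>k\<close> and \<open>- k\<close> share one cosine, hence
    the factor 2 for all \<open>k\<close> except 0.\<close>
  define c where "c k = (if k = 0 then 1 else 2) * cos_coeff F (int k)" for k
  have nonneg: "c k \<ge> 0" for k
  proof -
    have "Re (fourier_coeff f (int k)) \<ge> 0"
      using pd unfolding positive_definite_def by (simp add: complex_nonneg_Reals_iff)
    then show ?thesis
      using contF by (simp add: c_def Re_fourier_coeff[of f, unfolded F_eq])
  qed
  obtain B where B: "\<And>n. n \<noteq> 0 \<Longrightarrow> \<bar>cos_coeff F n\<bar> \<le> B / (of_int n)\<^sup>2"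
    using C2_circle_cos_coeff_bound[OF C2] unfolding F_def by blast
  have summ: "summable c"
  proof (rule summable_comparison_test)
    have "norm (c n) \<le> 2 * B * inverse ((of_nat n)\<^sup>2)" if "n \<ge> 1" for n
      using B[of "int n"] that by (simp add: c_def abs_mult divide_inverse)
    then show "\<exists>N. \<forall>n\<ge>N. norm (c n) \<le> 2 * B * inverse ((of_nat n)\<^sup>2)" by blast
    show "summable (\<lambda>n. 2 * B * inverse ((of_nat n)\<^sup>2))"
      by (intro summable_mult inverse_power_summable) auto
  qed
  \<comment> \<open>\<open>H\<close> is the candidate expansion. It converges absolutely, so it is
    continuous and has computable coefficients; once its cosine and sine integrals are shown to
    agree with those of \<open>F\<close>, uniqueness gives \<open>F = H\<close>.\<close>
  define H where "H t = (\<Sum>k. c k * cos (of_nat k * t))" for t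
  interpret cs: cosine_series c H
  proof
    show "(\<lambda>k. c k * cos (of_nat k * t)) sums H t" for t
      unfolding H_def
    proof (rule summable_sums, rule summable_comparison_test[OF _ summ], intro exI allI impI)
      show "norm (c k * cos (of_nat k * t)) \<le> c k" for k
        using mult_left_mono[OF abs_cos_le_one nonneg] by (simp add: abs_mult nonneg)
    qed
  qed (fact nonneg summ)+
  have cos_H: "integral {0..2*pi} (\<lambda>t. H t * cos (of_int n * t)) = integral {0..2*pi} (\<lambda>t. F t * cos (of_int n * t))" for n
  proof -
    \<comment> \<open>The power recursion at exponent 0 computes the coefficients of
      \<open>H\<close> itself: the constant 1 has mass only at frequency 0, so only
      \<open>k = nat \<bar>n\<bar>\<close> survives. For \<open>n = 0\<close> both shifts
      contribute, otherwise exactly one does, which undoes the factor 2 in \<open>c\<close>.\<close>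
    have *: "c k / 2 * (cos_coeff (\<lambda>t. H t ^ 0) (n - int k) + cos_coeff (\<lambda>t. H t ^ 0) (n + int k))
         = (if k = nat \<bar>n\<bar> then cos_coeff F n else 0)" for k
    proof -
      have even: "cos_coeff F (- m) = cos_coeff F m" for m by (simp add: cos_coeff_def)
      consider "n = 0" "k = 0" | "n = int k" "k > 0" | "n = - int k" "k > 0" | "n \<noteq> int k" "n \<noteq> - int k"
        by linarith
      then show ?thesis
        unfolding cs.cos_coeff_power_0 by cases (auto simp: c_def even)
    qed
    have "(\<lambda>k. if k = nat \<bar>n\<bar> then cos_coeff F n else 0) sums cos_coeff (\<lambda>t. H t ^ Suc 0) n"
      using cs.cos_coeff_power_Suc[of 0 n] unfolding * .
    then have "cos_coeff H n = cos_coeff F n"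
      using sums_single[of "nat \<bar>n\<bar>" "\<lambda>_. cos_coeff F n"] sums_unique2 by simp blast
    then show ?thesis by (simp add: cos_coeff_def)
  qed
  \<comment> \<open>Nonnegative Fourier coefficients are in particular real, so \<open>F\<close> has
    no sine part.\<close>
  have sin_F: "integral {0..2*pi} (\<lambda>t. F t * sin (of_int n * t)) = 0" for n
  proof -
    have "Im (fourier_coeff f n) = 0"
      using pd unfolding positive_definite_def by (simp add: complex_nonneg_Reals_iff)
    then show ?thesis
      using contF by (simp add: Im_fourier_coeff F_def)
  qed
  have sin_H: "integral {0..2*pi} (\<lambda>t. H t * sin (of_int n * t)) = 0" for n
  proof -
    let ?f = "\<lambda>k t. c k * cos (of_nat k * t) * sin (of_int n * t)"
    have "(\<lambda>k. integral {0..2*pi} (?f k)) sums integral {0..2*pi} (\<lambda>t. H t * sin (of_int n * t))"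
    proof (rule integral_sums)
      show "\<bar>?f k t\<bar> \<le> c k * 1" for k t
        unfolding abs_mult[of "_ * _" "sin (of_int n * t)"]
        by (intro mult_mono cs.term_bound nonneg) auto
    qed (auto intro!: continuous_intros summ sums_mult2 cs.sums)
    moreover have "integral {0..2*pi} (?f k) = 0" for k
    proof -
      have 1: "?f k t = c k / 2 * (sin (of_int (n + int k) * t) + sin (of_int (n - int k) * t))" for t
        by (simp add: algebra_simps sin_add sin_diff)
      have int: "(\<lambda>t. sin (of_int m * t)) integrable_on {0..2*pi}" for m
        by (intro integrable_continuous_real continuous_intros)
      show ?thesis
        unfolding 1 integral_mult_right
        by (subst integral_add[OF int int]) (simp only: integral_sin_int add_0 mult_zero_right)
    qed
    ultimately show ?thesis using sums_zero sums_unique2 by simp blast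
  qed
  have "F t = H t" for t
  proof -
    \<comment> \<open>\<open>fourier_unique\<close> speaks of functions of a point; by de Moivre,
      \<open>Re (z ^ k)\<close> at \<open>cis t\<close> is \<open>cos (k t)\<close>, so
      \<open>g\<close> represents \<open>F - H\<close>.\<close>
    define g where "g z = f z - (\<Sum>k. c k * Re (z ^ k))" for z
    have g: "g (cis t) = F t - H t" for t
      by (simp add: g_def F_def H_def Complex.DeMoivre)
    have "g (cis t) = 0"
    proof (rule fourier_unique)
      show "continuous_on UNIV (\<lambda>t. g (cis t))"
        unfolding g by (intro continuous_intros contF cs.continuous_on_sum)
      fix n :: int
      let ?i = "\<lambda>t. complex_of_real (g (cis t)) * cis (of_int n * t)"
      have int: "?i integrable_on {0..2*pi}"
        unfolding g by (intro integrable_continuous_real continuous_intros contF cs.continuous_on_sum)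
      have ints: "(\<lambda>t. F t * cos (of_int n * t)) integrable_on {0..2*pi}"
         "(\<lambda>t. H t * cos (of_int n * t)) integrable_on {0..2*pi}"
         "(\<lambda>t. F t * sin (of_int n * t)) integrable_on {0..2*pi}"
         "(\<lambda>t. H t * sin (of_int n * t)) integrable_on {0..2*pi}"
        by (intro integrable_continuous_real continuous_intros contF cs.continuous_on_sum)+
      have "Re (integral {0..2*pi} ?i) = integral {0..2*pi} (\<lambda>t. F t * cos (of_int n * t) - H t * cos (of_int n * t))"
        using integral_linear[OF int bounded_linear_Re] by (simp add: o_def g algebra_simps)
      also have "\<dots> = 0" by (simp only: integral_diff[OF ints(1,2)] cos_H)
      finally have re: "Re (integral {0..2*pi} ?i) = 0" .
      have "Im (integral {0..2*pi} ?i) = integral {0..2*pi} (\<lambda>t. F t * sin (of_int n * t) - H t * sin (of_int n * t))"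
        using integral_linear[OF int bounded_linear_Im] by (simp add: o_def g algebra_simps)
      also have "\<dots> = 0" by (simp only: integral_diff[OF ints(3,4)] sin_F sin_H)
      finally have "integral {0..2*pi} ?i = 0" using re by (simp add: complex_eq_iff)
      then show "(?i has_integral 0) {0..2*pi}" using int by (metis integrable_integral)
    qed
    then show ?thesis by (simp add: g)
  qed
  then have "(\<lambda>t. f (cis t)) = H" by (auto simp: F_def)
  then show ?thesis using that cs.cosine_series_axioms by metis
qed


section \<open>Positive semidefinite kernels\<close>

text \<open>
  The closed convex cone generated by rank one kernels. With this presentation of positive
  semidefiniteness the Schur product theorem needs no factorisation of matrices.
\<close>

inductive gram_kernel :: "('a \<Rightarrow> 'a \<Rightarrow> real) \<Rightarrow> bool" where
  rank_one: "gram_kernel (\<lambda>x y. u x * u y)"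
| add: "gram_kernel K \<Longrightarrow> gram_kernel L \<Longrightarrow> gram_kernel (\<lambda>x y. K x y + L x y)"
| lim: "(\<And>n. gram_kernel (K n)) \<Longrightarrow> (\<And>x y. (\<lambda>n. K n x y) \<longlonglongrightarrow> L x y) \<Longrightarrow> gram_kernel L"

lemma gram_kernel_zero: "gram_kernel (\<lambda>x y. 0)"
  using gram_kernel.rank_one[of "\<lambda>_. 0"] by simp

lemma gram_kernel_const: "a \<ge> 0 \<Longrightarrow> gram_kernel (\<lambda>x y. a)"
  using gram_kernel.rank_one[of "\<lambda>_. sqrt a"] by simp

lemma gram_kernel_sum:
  "(\<And>i. i \<in> I \<Longrightarrow> gram_kernel (K i)) \<Longrightarrow> gram_kernel (\<lambda>x y. \<Sum>i\<in>I. K i x y)"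
  by (induction I rule: infinite_finite_induct) (auto intro: gram_kernel_zero gram_kernel.add)

lemma gram_kernel_mult:
  assumes "gram_kernel K" "gram_kernel L"
  shows "gram_kernel (\<lambda>x y. K x y * L x y)"
  using assms(1)
proof induction
  case (rank_one u)
  from assms(2) show ?case
  proof induction
    case (rank_one v)
    have "gram_kernel (\<lambda>x y. (u x * v x) * (u y * v y))" by (rule gram_kernel.rank_one)
    then show ?case by (simp add: mult_ac)
  next
    case (add L M)
    then show ?case by (simp add: distrib_left gram_kernel.add)
  next
    case (lim L M)
    show ?case
      by (rule gram_kernel.lim[where K = "\<lambda>n x y. u x * u y * L n x y"]) (intro tendsto_intros lim)+
  qed
next
  case (add K M)
  then show ?case by (simp add: distrib_right gram_kernel.add)
next
  case (lim K M)
  show ?case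
    by (rule gram_kernel.lim[where K = "\<lambda>n x y. K n x y * L x y"]) (intro tendsto_intros lim)+
qed

lemma gram_kernel_prod:
  "(\<And>i. i \<in> I \<Longrightarrow> gram_kernel (K i)) \<Longrightarrow> gram_kernel (\<lambda>x y. \<Prod>i\<in>I. K i x y)"
  by (induction I rule: infinite_finite_induct) (auto intro: gram_kernel_const gram_kernel_mult)

lemma gram_kernel_pullback:
  assumes "gram_kernel K"
  shows "gram_kernel (\<lambda>x y. K (f x) (f y))"
  using assms
  by induction (rule gram_kernel.rank_one gram_kernel.add gram_kernel.lim; assumption)+

text \<open>On a rank one kernel the four terms factor as \<open>u (f x) + u (g x)\<close> times the
  same expression in \<open>y\<close>. With \<open>f\<close> and \<open>g\<close> the shifts by
  \<open>- a\<close> and \<open>a\<close>, this is the coefficient form of multiplying by a product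
  of two cosines.\<close>

lemma gram_kernel_pullback2:
  assumes "gram_kernel K"
  shows "gram_kernel (\<lambda>x y. K (f x) (f y) + K (f x) (g y) + K (g x) (f y) + K (g x) (g y))"
  using assms
proof induction
  case (rank_one u)
  have "gram_kernel (\<lambda>x y. (u (f x) + u (g x)) * (u (f y) + u (g y)))" by (rule gram_kernel.rank_one)
  then show ?case by (simp add: algebra_simps)
next
  case (add K L)
  from gram_kernel.add[OF add.IH] show ?case by (simp add: algebra_simps)
next
  case (lim K L)
  show ?case
    by (rule gram_kernel.lim[where K = "\<lambda>n x y. K n (f x) (f y) + K n (f x) (g y) + K n (g x) (f y) + K n (g x) (g y)"])
       (intro tendsto_intros lim)+
qed

lemma gram_kernel_quadratic_form_nonneg:
  assumes "gram_kernel K"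
  shows "(\<Sum>x\<in>A. \<Sum>y\<in>A. g x * g y * K x y) \<ge> 0"
  using assms
proof induction
  case (rank_one u)
  have "(\<Sum>x\<in>A. \<Sum>y\<in>A. g x * g y * (u x * u y)) = (\<Sum>x\<in>A. g x * u x)\<^sup>2"
    by (simp add: power2_eq_square sum_product mult_ac)
  then show ?case by simp
next
  case (add K L)
  then show ?case by (simp add: distrib_left sum.distrib)
next
  case (lim K L)
  have "(\<lambda>n. \<Sum>x\<in>A. \<Sum>y\<in>A. g x * g y * K n x y) \<longlonglongrightarrow> (\<Sum>x\<in>A. \<Sum>y\<in>A. g x * g y * L x y)"
    by (intro tendsto_intros lim.hyps)
  then show ?case by (rule LIMSEQ_le_const) (use lim.IH in auto)
qed

text \<open>
  The kernel \<open>k\<close> in the coordinates \<open>s = n + m\<close>, \<open>d = n - m\<close>, extended by zero to pairs of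
  different parity.
\<close>

definition parity_kernel :: "(int \<Rightarrow> int \<Rightarrow> real) \<Rightarrow> int \<Rightarrow> int \<Rightarrow> real" where
  "parity_kernel k s d = (if even (s + d) then k ((s + d) div 2) ((s - d) div 2) else 0)"

section \<open>Sum and difference coordinates on a single edge\<close>

lemma parity_kernel_shift:
  "parity_kernel (\<lambda>n m. k (n - a) m) s d = parity_kernel k (s - a) (d - a)"
  "parity_kernel (\<lambda>n m. k (n + a) m) s d = parity_kernel k (s + a) (d + a)"
  "parity_kernel (\<lambda>n m. k n (m - a)) s d = parity_kernel k (s - a) (d + a)"
  "parity_kernel (\<lambda>n m. k n (m + a)) s d = parity_kernel k (s + a) (d - a)"
proof -
  \<comment> \<open>Moving \<open>n\<close> moves \<open>s\<close> and \<open>d\<close> the same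
    way, moving \<open>m\<close> moves them in opposite ways. Either way \<open>s + d\<close>
    changes by an even number or not at all, so the parity condition is unaffected.\<close>
  have *: "(s - a + (d - a)) div 2 = (s + d) div 2 - a" "(s + a + (d + a)) div 2 = (s + d) div 2 + a"
    "(s - a - (d + a)) div 2 = (s - d) div 2 - a" "(s + a - (d - a)) div 2 = (s - d) div 2 + a"
    by presburger+
  show "parity_kernel (\<lambda>n m. k (n - a) m) s d = parity_kernel k (s - a) (d - a)"
    "parity_kernel (\<lambda>n m. k (n + a) m) s d = parity_kernel k (s + a) (d + a)"
    "parity_kernel (\<lambda>n m. k n (m - a)) s d = parity_kernel k (s - a) (d + a)"
    "parity_kernel (\<lambda>n m. k n (m + a)) s d = parity_kernel k (s + a) (d - a)"
    unfolding parity_kernel_def * by auto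
qed

text \<open>Split \<open>b'\<close> as \<open>(b' - b) + b\<close>. The excess \<open>b' - b\<close>
  multiplies pullbacks along a common shift of \<open>s\<close> and \<open>d\<close>. The shared
  part \<open>b\<close> multiplies all four combinations of the shifts by \<open>a\<close> and
  \<open>- a\<close>, which is \<open>gram_kernel_pullback2\<close>. The order of \<open>b\<close>
  and \<open>b'\<close> enters exactly in the sign of the excess.\<close>

lemma gram_parity_kernel_step:
  assumes "gram_kernel (parity_kernel k)" and "0 \<le> b" "b \<le> b'"
  shows "gram_kernel (parity_kernel (\<lambda>n m. b' * (k (n - a) m + k (n + a) m) + b * (k n (m - a) + k n (m + a))))"
proof -
  let ?K = "parity_kernel k"
  have "gram_kernel (\<lambda>s d. (b' - b) * (?K (s - a) (d - a) + ?K (s + a) (d + a)))"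
    using assms(2,3)
    by (intro gram_kernel_mult[OF gram_kernel_const] gram_kernel.add
        gram_kernel_pullback[OF assms(1), of "\<lambda>s. s - a"] gram_kernel_pullback[OF assms(1), of "\<lambda>s. s + a"]) simp
  moreover have "gram_kernel (\<lambda>s d.
      b * (?K (s - a) (d - a) + ?K (s - a) (d + a) + ?K (s + a) (d - a) + ?K (s + a) (d + a)))"
    using assms(2)
    by (intro gram_kernel_mult[OF gram_kernel_const]
        gram_kernel_pullback2[OF assms(1), of "\<lambda>s. s - a" "\<lambda>s. s + a"])
  ultimately have "gram_kernel (\<lambda>s d. (b' - b) * (?K (s - a) (d - a) + ?K (s + a) (d + a))
     + b * (?K (s - a) (d - a) + ?K (s - a) (d + a) + ?K (s + a) (d - a) + ?K (s + a) (d + a)))"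
    by (rule gram_kernel.add)
  also have "(\<lambda>s d. (b' - b) * (?K (s - a) (d - a) + ?K (s + a) (d + a))
     + b * (?K (s - a) (d - a) + ?K (s - a) (d + a) + ?K (s + a) (d - a) + ?K (s + a) (d + a)))
     = (\<lambda>s d. b' * (?K (s - a) (d - a) + ?K (s + a) (d + a)) + b * (?K (s - a) (d + a) + ?K (s + a) (d - a)))"
    by (simp add: algebra_simps)
  also have "\<dots> = parity_kernel (\<lambda>n m. b' * (k (n - a) m + k (n + a) m) + b * (k n (m - a) + k n (m + a)))"
    unfolding parity_kernel_shift[symmetric] by (auto simp: parity_kernel_def fun_eq_iff)
  finally show ?thesis .
qed

lemma gram_parity_kernel_sums:
  assumes "\<And>i. gram_kernel (parity_kernel (k i))" and "\<And>n m. (\<lambda>i. k i n m) sums l n m"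
  shows "gram_kernel (parity_kernel l)"
proof (rule gram_kernel.lim)
  show "gram_kernel (\<lambda>s d. \<Sum>i<N. parity_kernel (k i) s d)" for N
    by (intro gram_kernel_sum assms)
  show "(\<lambda>N. \<Sum>i<N. parity_kernel (k i) s d) \<longlonglongrightarrow> parity_kernel l s d" for s d
    using assms(2) by (auto simp: parity_kernel_def sums_def)
qed

lemma gram_parity_kernel_scale:
  assumes "gram_kernel (parity_kernel k)" and "a \<ge> 0"
  shows "gram_kernel (parity_kernel (\<lambda>n m. a * k n m))"
proof -
  have "parity_kernel (\<lambda>n m. a * k n m) = (\<lambda>s d. a * parity_kernel k s d)"
    by (auto simp: parity_kernel_def fun_eq_iff)
  then show ?thesis using assms by (auto intro: gram_kernel_mult gram_kernel_const)
qed

section \<open>The joint weight of one edge is a Gram kernel\<close>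

context cosine_series
begin

lemma gram_parity_kernel_exp:
  assumes b: "0 \<le> b" "b \<le> b'"
  shows "gram_kernel (parity_kernel (\<lambda>n m. cos_coeff (\<lambda>t. exp (b' * F t)) n * cos_coeff (\<lambda>t. exp (b * F t)) m))"
proof -
  define x where "x b p n = b ^ p / fact p * cos_coeff (\<lambda>t. F t ^ p) n" for b p n
  \<comment> \<open>\<open>T j\<close> collects the terms of total degree \<open>j\<close> of the two exponential series. The
    differential equation of the exponential becomes \<open>T_Suc\<close>: \<open>(j + 1) * T (j + 1)\<close> is obtained
    from \<open>T j\<close> by shifts that preserve the cone.\<close>
  define T where "T j n m = (\<Sum>p\<le>j. x b' p n * x b (j - p) m)" for j n m
  have x_Suc: "(\<lambda>k. c k / 2 * (b * (x b p (n - int k) + x b p (n + int k)))) sums (of_nat (Suc p) * x b (Suc p) n)" for b p n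
  proof -
    have "of_nat (Suc p) * x b (Suc p) n = b ^ Suc p / fact p * cos_coeff (\<lambda>t. F t ^ Suc p) n"
      unfolding x_def by (simp add: field_simps del: of_nat_Suc power_Suc)
    then show ?thesis
      using sums_mult[OF cos_coeff_power_Suc[of p n], of "b ^ Suc p / fact p"]
      by (simp add: x_def algebra_simps)
  qed
  have T_Suc: "(\<lambda>k. c k / 2 * (b' * (T j (n - int k) m + T j (n + int k) m) + b * (T j n (m - int k) + T j n (m + int k))))
     sums (of_nat (Suc j) * T (Suc j) n m)" for j n m
  proof -
    have a1: "(\<lambda>k. \<Sum>p\<le>j. c k / 2 * (b' * (x b' p (n - int k) + x b' p (n + int k))) * x b (j - p) m
        + x b' p n * (c k / 2 * (b * (x b (j - p) (m - int k) + x b (j - p) (m + int k)))))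
      sums (\<Sum>p\<le>j. of_nat (Suc p) * x b' (Suc p) n * x b (j - p) m
        + x b' p n * (of_nat (Suc (j - p)) * x b (Suc (j - p)) m))"
      by (intro sums_sum sums_add sums_mult sums_mult2 x_Suc)
    have a2: "(\<Sum>p\<le>j. c k / 2 * (b' * (x b' p (n - int k) + x b' p (n + int k))) * x b (j - p) m
        + x b' p n * (c k / 2 * (b * (x b (j - p) (m - int k) + x b (j - p) (m + int k)))))
      = c k / 2 * (b' * (T j (n - int k) m + T j (n + int k) m) + b * (T j n (m - int k) + T j n (m + int k)))" for k
      unfolding T_def sum_distrib_left sum.distrib[symmetric]
      by (intro sum.cong refl) (simp add: algebra_simps add_divide_distrib)
    \<comment> \<open>Both sums extend to \<open>p \<le> Suc j\<close> by a vanishing term, at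
      \<open>p = 0\<close> in the first and at \<open>p = Suc j\<close> in the second. Their factors
      \<open>p\<close> and \<open>Suc j - p\<close> then add up to \<open>Suc j\<close>.\<close>
    have a3: "(\<Sum>p\<le>j. of_nat (Suc p) * x b' (Suc p) n * x b (j - p) m
        + x b' p n * (of_nat (Suc (j - p)) * x b (Suc (j - p)) m)) = of_nat (Suc j) * T (Suc j) n m"
    proof -
      have "(\<Sum>p\<le>Suc j. of_nat p * x b' p n * x b (Suc j - p) m)
          = (\<Sum>p\<le>j. of_nat (Suc p) * x b' (Suc p) n * x b (j - p) m)"
        by (subst sum.atMost_Suc_shift) simp
      moreover have "(\<Sum>p\<le>Suc j. x b' p n * (of_nat (Suc j - p) * x b (Suc j - p) m))
          = (\<Sum>p\<le>j. x b' p n * (of_nat (Suc (j - p)) * x b (Suc (j - p)) m))"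
      proof -
        have "(\<Sum>p\<le>Suc j. x b' p n * (of_nat (Suc j - p) * x b (Suc j - p) m))
            = (\<Sum>p\<le>j. x b' p n * (of_nat (Suc j - p) * x b (Suc j - p) m))"
          by (subst sum.atMost_Suc) simp
        also have "\<dots> = (\<Sum>p\<le>j. x b' p n * (of_nat (Suc (j - p)) * x b (Suc (j - p)) m))"
          by (intro sum.cong refl) (simp only: Suc_diff_le atMost_iff)
        finally show ?thesis .
      qed
      moreover have "of_nat (Suc j) * T (Suc j) n m
          = (\<Sum>p\<le>Suc j. of_nat p * x b' p n * x b (Suc j - p) m)
            + (\<Sum>p\<le>Suc j. x b' p n * (of_nat (Suc j - p) * x b (Suc j - p) m))"
        unfolding T_def sum_distrib_left sum.distrib[symmetric]
        by (intro sum.cong refl) (simp add: of_nat_diff algebra_simps)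
      ultimately show ?thesis by (simp only: sum.distrib)
    qed
    from a1 show ?thesis unfolding a2 a3 .
  qed
  have "gram_kernel (parity_kernel (T j))" for j
  proof (induction j)
    case 0
    \<comment> \<open>The recursion starts from the unit mass at the origin, which in the
      coordinates \<open>s\<close>, \<open>d\<close> is the rank one product of the indicators of
      \<open>s = 0\<close> and \<open>d = 0\<close>.\<close>
    have T0: "T 0 n m = (if n = 0 \<and> m = 0 then 1 else 0)" for n m
      using cos_coeff_power_0 by (simp add: T_def x_def)
    have key: "even (s + d) \<and> (s + d) div 2 = 0 \<and> (s - d) div 2 = 0 \<longleftrightarrow> s = 0 \<and> d = 0" for s d :: int
      by presburger
    have "parity_kernel (T 0) s d = (if even (s + d) \<and> (s + d) div 2 = 0 \<and> (s - d) div 2 = 0 then 1 else 0)" for s d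
      unfolding parity_kernel_def T0 by (cases "even (s + d)") (simp_all only: simp_thms if_True if_False)
    then have "parity_kernel (T 0) = (\<lambda>s d. (if s = 0 then 1 else 0) * (if d = 0 then 1 else 0))"
      unfolding key by (auto simp: fun_eq_iff)
    then show ?case using gram_kernel.rank_one by simp
  next
    case (Suc j)
    have "gram_kernel (parity_kernel (\<lambda>n m. of_nat (Suc j) * T (Suc j) n m))"
      by (rule gram_parity_kernel_sums[OF gram_parity_kernel_scale[OF gram_parity_kernel_step[OF Suc b]] T_Suc])
        (use nonneg in simp)
    from gram_parity_kernel_scale[OF this, of "1 / of_nat (Suc j)"]
    show ?case by (simp del: of_nat_Suc)
  qed
  moreover have "(\<lambda>j. T j n m) sums (cos_coeff (\<lambda>t. exp (b' * F t)) n * cos_coeff (\<lambda>t. exp (b * F t)) m)" for n m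
  proof -
    have nn: "x q p n \<ge> 0" if "q \<ge> 0" for q p n
      unfolding x_def using that cos_coeff_power_nonneg by simp
    have s: "(\<lambda>p. x q p n) sums cos_coeff (\<lambda>t. exp (q * F t)) n" for q n
      unfolding x_def by (rule cos_coeff_exp_sums)
    have "summable (\<lambda>p. norm (x q p n))" if "q \<ge> 0" for q n
      using nn[OF that] sums_summable[OF s] by simp
    then have "(\<lambda>j. T j n m) sums ((\<Sum>p. x b' p n) * (\<Sum>p. x b p m))"
      unfolding T_def using b by (intro Cauchy_product_sums) auto
    then show ?thesis by (simp add: sums_unique[OF s, symmetric])
  qed
  ultimately show ?thesis by (rule gram_parity_kernel_sums)
qed

end


section \<open>Height functions\<close>

lemma has_sum_Times_mult:
  fixes f g :: "'a \<Rightarrow> real"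
  assumes "f summable_on A" "g summable_on B" "\<And>x. x \<in> A \<Longrightarrow> f x \<ge> 0" "\<And>y. y \<in> B \<Longrightarrow> g y \<ge> 0"
  shows "((\<lambda>(x, y). f x * g y) has_sum (infsum f A * infsum g B)) (A \<times> B)"
proof (rule has_sum_SigmaI)
  show 1: "((\<lambda>y. case (x, y) of (x, y) \<Rightarrow> f x * g y) has_sum (f x * infsum g B)) B" for x
    using has_sum_cmult_right[OF has_sum_infsum[OF assms(2)]] by simp
  show 2: "((\<lambda>x. f x * infsum g B) has_sum (infsum f A * infsum g B)) A"
    using has_sum_cmult_left[OF has_sum_infsum[OF assms(1)]] by simp
  show "(\<lambda>(x, y). f x * g y) summable_on A \<times> B"
    by (rule summable_on_SigmaI[OF 1]) (use 2 assms(3,4) in \<open>auto simp: summable_on_def\<close>)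
qed

text \<open>Quadratic forms control only sums over squares \<open>B \<times> B\<close>. Every finite
  set of pairs lies in such a square, with \<open>B\<close> the union of its two projections, so the
  squares are cofinal and determine the sign of the limit.\<close>

lemma has_sum_square_nonneg:
  fixes f :: "'a \<times> 'a \<Rightarrow> real"
  assumes "(f has_sum S) (A \<times> A)"
    and nonneg: "\<And>B. finite B \<Longrightarrow> B \<subseteq> A \<Longrightarrow> sum f (B \<times> B) \<ge> 0"
  shows "S \<ge> 0"
proof (rule ccontr)
  assume "\<not> S \<ge> 0"
  then have "\<forall>\<^sub>F X in finite_subsets_at_top (A \<times> A). sum f X < 0"
    using assms(1) unfolding has_sum_def by (intro order_tendstoD(2)) auto
  then obtain X where X: "finite X" "X \<subseteq> A \<times> A"
      "\<And>Y. finite Y \<Longrightarrow> X \<subseteq> Y \<Longrightarrow> Y \<subseteq> A \<times> A \<Longrightarrow> sum f Y < 0"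
    unfolding eventually_finite_subsets_at_top by metis
  define B where "B = fst ` X \<union> snd ` X"
  have B: "finite B" "B \<subseteq> A" "X \<subseteq> B \<times> B"
    using X(1,2) by (force simp: B_def)+
  then have "sum f (B \<times> B) < 0" by (intro X(3)) auto
  then show False using nonneg[OF B(1,2)] by simp
qed

lemma nn_integral_count_space_eq_infsum:
  assumes "f summable_on A" "\<And>x. x \<in> A \<Longrightarrow> f x \<ge> (0::real)"
  shows "(\<integral>\<^sup>+x. ennreal (f x) \<partial>count_space A) = ennreal (infsum f A)"
proof -
  have "(\<lambda>x. norm (f x)) summable_on A"
    using assms by (auto cong: summable_on_cong)
  then have "Infinite_Set_Sum.abs_summable_on f A"
    using abs_summable_equivalent by blast
  then show ?thesis
    using nn_integral_conv_infsetsum[of f A] infsetsum_infsum[of f A] assms(2) by simp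
qed

lemma exp_ereal_minus_sum:
  assumes "finite A" and "\<And>a. a \<in> A \<Longrightarrow> w a \<ge> 0"
  shows "exp_ereal (- (\<Sum>a\<in>A. if w a = 0 then \<infinity> else ereal (- ln (w a)))) = ennreal (\<Prod>a\<in>A. w a)"
proof (cases "\<exists>a\<in>A. w a = 0")
  case True
  then have "(\<Sum>a\<in>A. if w a = 0 then \<infinity> else ereal (- ln (w a))) = \<infinity>"
    using assms(1) by (subst sum_Pinfty) auto
  moreover have "(\<Prod>a\<in>A. w a) = 0"
    using True assms(1) by (auto intro: prod_zero)
  ultimately show ?thesis by (simp add: exp_ereal_def)
next
  case False
  then have "(\<Sum>a\<in>A. if w a = 0 then \<infinity> else ereal (- ln (w a))) = (\<Sum>a\<in>A. ereal (- ln (w a)))"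
    by (intro sum.cong) auto
  moreover have "exp (\<Sum>a\<in>A. ln (w a)) = (\<Prod>a\<in>A. w a)"
    using False assms by (subst exp_sum) (auto intro!: prod.cong exp_ln simp: order_less_le)
  ultimately show ?thesis by (simp add: exp_ereal_def sum_negf)
qed

section \<open>Height functions on a connected rooted graph with general edge weights\<close>

locale rooted_graph = fin_digraph G for G :: "('v, 'e) pre_digraph" +
  fixes r :: 'v
  assumes conn: "Digraph_Component.connected G" and root: "r \<in> verts G"
begin

text \<open>A path from the root may traverse arcs against their orientation, so the step is an
  equivalence between the two endpoints.\<close>

lemma verts_induct_connected:
  assumes "v \<in> verts G" and "P r" and "\<And>a. a \<in> arcs G \<Longrightarrow> P (tail G a) \<longleftrightarrow> P (head G a)"
  shows "P v"
proof -
  have "(r, v) \<in> rtrancl_on (verts G) ((arcs_ends G)\<^sup>s)"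
    using conn root assms(1) unfolding connected_conv by blast
  then show ?thesis
  proof (induction rule: rtrancl_on_induct)
    case (step y z)
    then show ?case using assms(3) by (auto simp: symcl_def arcs_ends_conv)
  qed (rule assms(2))
qed

lemma heights_eqI:
  assumes h: "h \<in> heights G r" "h' \<in> heights G r"
    and "\<And>a. a \<in> arcs G \<Longrightarrow> grad G h a = grad G h' a"
  shows "h = h'"
proof (rule PiE_ext[of h "verts G" "\<lambda>_. UNIV"])
  show "h \<in> verts G \<rightarrow>\<^sub>E UNIV" "h' \<in> verts G \<rightarrow>\<^sub>E UNIV"
    using h by (auto simp: heights_def)
  show "h v = h' v" if "v \<in> verts G" for v
    using that
  proof (rule verts_induct_connected[where P = "\<lambda>v. h v = h' v"])
    show "h r = h' r" using h by (simp add: heights_def)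
    show "h (tail G a) = h' (tail G a) \<longleftrightarrow> h (head G a) = h' (head G a)" if "a \<in> arcs G" for a
      using assms(3)[OF that] by (auto simp: grad_def)
  qed
qed

text \<open>Parity propagates from the root, where both heights are 0. Used contrapositively: a
  vertex of mismatched parity forces an arc of mismatched parity.\<close>

lemma even_heights_if_even_grad:
  assumes "h \<in> heights G r" "h' \<in> heights G r" and "v \<in> verts G"
    and "\<And>a. a \<in> arcs G \<Longrightarrow> even (grad G h a + grad G h' a)"
  shows "even (h v + h' v)"
  using assms(3)
proof (rule verts_induct_connected[where P = "\<lambda>v. even (h v + h' v)"])
  show "even (h r + h' r)" using assms(1,2) by (simp add: heights_def)
  show "even (h (tail G a) + h' (tail G a)) \<longleftrightarrow> even (h (head G a) + h' (head G a))" if "a \<in> arcs G" for a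
    using assms(4)[OF that] by (auto simp: grad_def)
qed

definition weight :: "('e \<Rightarrow> int \<Rightarrow> real) \<Rightarrow> ('v \<Rightarrow> int) \<Rightarrow> real" where
  "weight w h = (\<Prod>a\<in>arcs G. w a (grad G h a))"

text \<open>The bound on finite sums makes the partition sum finite, and positivity at 0 gives the
  zero height function positive weight, so that the partition sum is nonzero.\<close>

definition admissible :: "('e \<Rightarrow> int \<Rightarrow> real) \<Rightarrow> bool" where
  "admissible w \<longleftrightarrow> (\<forall>a\<in>arcs G. (\<forall>n. w a n \<ge> 0) \<and> w a 0 > 0 \<and> (\<exists>C. \<forall>N. finite N \<longrightarrow> sum (w a) N \<le> C))"

lemma weight_nonneg: "admissible w \<Longrightarrow> weight w h \<ge> 0"
  unfolding weight_def admissible_def by (intro prod_nonneg) auto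

text \<open>
  A height function is determined by its gradient, so the sum is dominated by the sum over all
  integer 1-forms, which factorises over the edges.
\<close>

lemma weight_summable:
  assumes "admissible w"
  shows "weight w summable_on heights G r"
proof (rule nonneg_bdd_above_summable_on)
  show "weight w h \<ge> 0" for h by (rule weight_nonneg[OF assms])
  obtain C where C: "\<And>a N. a \<in> arcs G \<Longrightarrow> finite N \<Longrightarrow> sum (w a) N \<le> C a"
    using assms unfolding admissible_def by metis
  have "sum (weight w) F \<le> (\<Prod>a\<in>arcs G. C a)" if F: "F \<subseteq> heights G r" "finite F" for F
  proof -
    define g where "g h = restrict (grad G h) (arcs G)" for h
    define N where "N a = (\<lambda>h. grad G h a) ` F" for a
    have inj: "inj_on g F"
    proof (rule inj_onI)
      fix h h' assume h: "h \<in> F" "h' \<in> F" and eq: "g h = g h'"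
      show "h = h'"
      proof (rule heights_eqI)
        show "grad G h a = grad G h' a" if "a \<in> arcs G" for a
          using fun_cong[OF eq, of a] that by (simp add: g_def)
      qed (use h F in auto)
    qed
    have "sum (weight w) F = (\<Sum>h\<in>F. \<Prod>a\<in>arcs G. w a (g h a))"
      by (simp add: weight_def g_def)
    also have "\<dots> = (\<Sum>n\<in>g ` F. \<Prod>a\<in>arcs G. w a (n a))"
      by (simp add: sum.reindex[OF inj])
    also have "\<dots> \<le> (\<Sum>n\<in>Pi\<^sub>E (arcs G) N. \<Prod>a\<in>arcs G. w a (n a))"
      using F assms by (intro sum_mono2 prod_nonneg finite_PiE finite_arcs)
        (auto simp: g_def N_def admissible_def)
    also have "\<dots> = (\<Prod>a\<in>arcs G. sum (w a) (N a))"
      using F by (intro prod_sum_PiE[symmetric] finite_arcs) (auto simp: N_def)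
    also have "\<dots> \<le> (\<Prod>a\<in>arcs G. C a)"
      using F assms by (intro prod_mono) (auto simp: N_def admissible_def intro!: C sum_nonneg)
    finally show ?thesis .
  qed
  then show "bdd_above (sum (weight w) ` {F. F \<subseteq> heights G r \<and> finite F})"
    by (intro bdd_aboveI[of _ "\<Prod>a\<in>arcs G. C a"]) auto
qed

lemma infsum_weight_pos:
  assumes "admissible w"
  shows "infsum (weight w) (heights G r) > 0"
proof -
  define h0 :: "'v \<Rightarrow> int" where "h0 = (\<lambda>v\<in>verts G. 0)"
  have h0: "h0 \<in> heights G r" using root by (auto simp: heights_def h0_def)
  have "0 < weight w h0"
    unfolding weight_def using assms
    by (intro prod_pos) (auto simp: grad_def h0_def admissible_def)
  also have "weight w h0 = sum (weight w) {h0}" by simp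
  also have "\<dots> \<le> infsum (weight w) (heights G r)"
    using h0 weight_nonneg[OF assms]
    by (intro finite_sum_le_infsum weight_summable assms) auto
  finally show ?thesis .
qed

text \<open>The inverse halves \<open>s + d\<close> and \<open>s - d\<close>, which is possible over
  the integers exactly when \<open>s\<close> and \<open>d\<close> have equal parity at each vertex.
  Restriction to the vertices keeps the functions extensional.\<close>

lemma sum_diff_heights_bij_betw:
  "bij_betw (\<lambda>(h, h'). (\<lambda>v\<in>verts G. h v + h' v, \<lambda>v\<in>verts G. h v - h' v)) (heights G r \<times> heights G r)
     {(s, d). s \<in> heights G r \<and> d \<in> heights G r \<and> (\<forall>v\<in>verts G. even (s v + d v))}"
    (is "bij_betw ?f ?A ?B")
proof -
  define f' :: "('v \<Rightarrow> int) \<times> ('v \<Rightarrow> int) \<Rightarrow> ('v \<Rightarrow> int) \<times> ('v \<Rightarrow> int)"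
    where "f' = (\<lambda>(s, d). (\<lambda>v\<in>verts G. (s v + d v) div 2, \<lambda>v\<in>verts G. (s v - d v) div 2))"
  show ?thesis
  proof (rule bij_betw_byWitness[where f' = f'])
    show "\<forall>p\<in>?A. f' (?f p) = p"
      by (auto simp: f'_def heights_def fun_eq_iff PiE_def extensional_def)
    show "\<forall>p\<in>?B. ?f (f' p) = p"
    proof safe
      fix s d assume s: "s \<in> heights G r" "d \<in> heights G r" and ev: "\<forall>v\<in>verts G. even (s v + d v)"
      have "(s v + d v) div 2 + (s v - d v) div 2 = s v" "(s v + d v) div 2 - (s v - d v) div 2 = d v" if "v \<in> verts G" for v
        using ev[rule_format, OF that] by presburger+
      then show "?f (f' (s, d)) = (s, d)"
        using s by (auto simp: f'_def heights_def fun_eq_iff PiE_def extensional_def)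
    qed
    show "?f ` ?A \<subseteq> ?B" "f' ` ?B \<subseteq> ?A"
      using root by (auto simp: f'_def heights_def)
  qed
qed

text \<open>Clearing denominators turns the comparison of expectations into the sign of one double
  sum \<open>S\<close> over pairs \<open>(h, h')\<close>. In the proof it is \<open>h\<close> that
  carries the weight \<open>w'\<close> and \<open>h'\<close> that carries \<open>w\<close>.\<close>

lemma infsum_cos_comparison:
  fixes t :: real
  assumes w: "admissible w" and w': "admissible w'"
    and gram: "\<And>a. a \<in> arcs G \<Longrightarrow> gram_kernel (parity_kernel (\<lambda>n m. w' a n * w a m))"
    and x: "x \<in> verts G" and y: "y \<in> verts G"
  defines "X \<equiv> \<lambda>h. 1 - cos (2 * t * of_int (h x - h y))"
  shows "infsum (\<lambda>h. X h * weight w h) (heights G r) * infsum (weight w') (heights G r)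
     \<le> infsum (\<lambda>h. X h * weight w' h) (heights G r) * infsum (weight w) (heights G r)"
proof -
  define H where "H = heights G r"
  define sumh where "sumh h h' = (\<lambda>v\<in>verts G. h v + (h' v :: int))" for h h'
  define diffh where "diffh h h' = (\<lambda>v\<in>verts G. h v - (h' v :: int))" for h h'
  define R where "R = {(s, d). s \<in> H \<and> d \<in> H \<and> (\<forall>v\<in>verts G. even (s v + d v))}"
  have bij: "bij_betw (\<lambda>(h, h'). (sumh h h', diffh h h')) (H \<times> H) R"
    using sum_diff_heights_bij_betw unfolding H_def R_def sumh_def diffh_def .
  have X0: "X h \<ge> 0" and X2: "X h \<le> 2" for h
    using cos_le_one[of "2 * t * of_int (h x - h y)"] cos_ge_minus_one[of "2 * t * of_int (h x - h y)"]
    unfolding X_def by linarith+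
  have sw: "weight v summable_on H" if "admissible v" for v
    unfolding H_def by (rule weight_summable[OF that])
  have sX: "(\<lambda>h. X h * weight v h) summable_on H" if v: "admissible v" for v
  proof (rule summable_on_comparison_test)
    show "(\<lambda>h. 2 * weight v h) summable_on H" by (intro summable_on_cmult_right sw v)
    show "X h * weight v h \<le> 2 * weight v h" "0 \<le> X h * weight v h" for h
      using X0 X2 weight_nonneg[OF v] by (auto intro: mult_right_mono)
  qed
  have nn: "X h * weight w h \<ge> 0" "X h * weight w' h \<ge> 0" for h
    using X0 weight_nonneg[OF w] weight_nonneg[OF w'] by auto
  define S where "S = infsum (\<lambda>h. X h * weight w' h) H * infsum (weight w) H
      - infsum (weight w') H * infsum (\<lambda>h. X h * weight w h) H"
  have "((\<lambda>p. (case p of (h, h') \<Rightarrow> (X h * weight w' h) * weight w h')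
       + - (case p of (h, h') \<Rightarrow> weight w' h * (X h' * weight w h'))) has_sum S) (H \<times> H)"
    unfolding S_def diff_conv_add_uminus
    by (intro has_sum_add has_sum_uminusI has_sum_Times_mult sw sX w w' nn weight_nonneg)
  also have "?this \<longleftrightarrow> ((\<lambda>(h, h'). (X h - X h') * (weight w' h * weight w h')) has_sum S) (H \<times> H)"
    by (intro has_sum_cong) (auto simp: algebra_simps)
  finally have 1: "((\<lambda>(h, h'). (X h - X h') * (weight w' h * weight w h')) has_sum S) (H \<times> H)" .
  \<comment> \<open>\<open>K\<close> is the joint weight in the new coordinates, but defined for all
    pairs \<open>(s, d)\<close>, including those that come from no pair of integer height
    functions.\<close>
  define K where "K s d = (\<Prod>a\<in>arcs G. parity_kernel (\<lambda>n m. w' a n * w a m) (grad G s a) (grad G d a))" for s d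
  define g where "g s = sin (t * of_int (s x - s y))" for s :: "'v \<Rightarrow> int"
  define \<Phi> where "\<Phi> = (\<lambda>(s, d). 2 * (g s * g d * K s d))"
  have "\<Phi> (sumh h h', diffh h h') = (X h - X h') * (weight w' h * weight w h')" for h h'
  proof -
    have "parity_kernel (\<lambda>n m. w' a n * w a m) (grad G (sumh h h') a) (grad G (diffh h h') a)
        = w' a (grad G h a) * w a (grad G h' a)" if "a \<in> arcs G" for a
    proof -
      have "grad G (sumh h h') a = grad G h a + grad G h' a" "grad G (diffh h h') a = grad G h a - grad G h' a"
        using that by (simp_all add: grad_def sumh_def diffh_def)
      then show ?thesis by (simp add: parity_kernel_def)
    qed
    then have "K (sumh h h') (diffh h h') = weight w' h * weight w h'"
      by (simp add: K_def weight_def prod.distrib)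
    moreover have "2 * (g (sumh h h') * g (diffh h h')) = X h - X h'"
    proof -
      define p q where "p = t * of_int (h x - h y)" and "q = t * of_int (h' x - h' y)"
      have "g (sumh h h') = sin (p + q)" "g (diffh h h') = sin (p - q)"
        using x y by (simp_all add: g_def sumh_def diffh_def p_def q_def algebra_simps)
      moreover have "X h = 1 - cos (2 * p)" "X h' = 1 - cos (2 * q)"
        by (simp_all add: X_def p_def q_def mult.assoc)
      moreover have "sin (p + q) * sin (p - q) = (cos (2 * q) - cos (2 * p)) / 2"
        by (subst sin_times_sin) (simp add: algebra_simps)
      ultimately show ?thesis by simp
    qed
    ultimately show ?thesis by (simp add: \<Phi>_def)
  qed
  then have "(\<lambda>(h, h'). (X h - X h') * (weight w' h * weight w h')) = (\<lambda>p. \<Phi> ((\<lambda>(h, h'). (sumh h h', diffh h h')) p))"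
    by auto
  with 1 have sumR: "(\<Phi> has_sum S) R"
    using has_sum_reindex_bij_betw[OF bij, of \<Phi> S] by simp
  \<comment> \<open>Quadratic forms need the full square \<open>H \<times> H\<close> instead of
    \<open>R\<close>. Outside \<open>R\<close> some arc has an odd gradient sum, and its factor in
    \<open>K\<close> vanishes.\<close>
  have "(\<Phi> has_sum S) R \<longleftrightarrow> (\<Phi> has_sum S) (H \<times> H)"
  proof (rule has_sum_cong_neutral)
    fix p assume "p \<in> H \<times> H - R"
    then obtain s d v where p: "p = (s, d)" "s \<in> H" "d \<in> H" "v \<in> verts G" "odd (s v + d v)"
      by (auto simp: R_def)
    then obtain a where a: "a \<in> arcs G" "odd (grad G s a + grad G d a)"
      using even_heights_if_even_grad[of s d v] unfolding H_def by blast
    have "parity_kernel (\<lambda>n m. w' a n * w a m) (grad G s a) (grad G d a) = 0"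
      unfolding parity_kernel_def using a(2) by (rule if_not_P)
    then have "K s d = 0"
      unfolding K_def using a(1) by (intro prod_zero finite_arcs) blast
    then show "\<Phi> p = 0" by (simp add: \<Phi>_def p)
  next
    have "R \<subseteq> H \<times> H" by (auto simp: R_def)
    then show "\<Phi> p = 0" if "p \<in> R - H \<times> H" for p using that by blast
  qed (rule refl)
  with sumR have sum\<Phi>: "(\<Phi> has_sum S) (H \<times> H)" by blast
  have gK: "gram_kernel K"
    unfolding K_def
    by (rule gram_kernel_prod, rule gram_kernel_pullback[OF gram, where f = "\<lambda>s. grad G s _"])
  have "S \<ge> 0"
  proof (rule has_sum_square_nonneg[OF sum\<Phi>])
    fix B :: "('v \<Rightarrow> int) set" assume "finite B"
    have "sum \<Phi> (B \<times> B) = 2 * (\<Sum>s\<in>B. \<Sum>d\<in>B. g s * g d * K s d)"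
      by (simp add: \<Phi>_def sum.cartesian_product[symmetric] sum_distrib_left)
    also have "\<dots> \<ge> 0"
      using gram_kernel_quadratic_form_nonneg[OF gK] by simp
    finally show "sum \<Phi> (B \<times> B) \<ge> 0" .
  qed
  then show ?thesis by (simp add: S_def H_def mult.commute)
qed

end


section \<open>Approximation of the square by bounded cosine observables\<close>

lemma tendsto_scaled_one_minus_cos:
  "(\<lambda>n. 2 * (real (Suc n))\<^sup>2 * (1 - cos (x / real (Suc n)))) \<longlonglongrightarrow> x\<^sup>2"
proof -
  \<comment> \<open>By the half-angle formula each term is the square of
    \<open>2 * sin (x / 2 * z) / z\<close> at \<open>z = 1 / Suc n\<close>, a difference quotient at
    0.\<close>
  have "((\<lambda>z. sin (x / 2 * z)) has_real_derivative x / 2) (at 0)"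
    by (auto intro!: derivative_eq_intros)
  then have "((\<lambda>z. sin (x / 2 * z) / z) \<longlongrightarrow> x / 2) (at 0)"
    by (simp add: DERIV_def)
  moreover have "filterlim (\<lambda>n. inverse (real (Suc n))) (at 0) sequentially"
    unfolding filterlim_at using LIMSEQ_inverse_real_of_nat by auto
  ultimately have "(\<lambda>n. sin (x / 2 * inverse (real (Suc n))) / inverse (real (Suc n))) \<longlonglongrightarrow> x / 2"
    by (rule filterlim_compose)
  then have "(\<lambda>n. (2 * (sin (x / 2 * inverse (real (Suc n))) / inverse (real (Suc n))))\<^sup>2) \<longlonglongrightarrow> (2 * (x / 2))\<^sup>2"
    by (intro tendsto_power tendsto_mult tendsto_const)
  moreover have "(2 * (sin (x / 2 * inverse (real (Suc n))) / inverse (real (Suc n))))\<^sup>2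
      = 2 * (real (Suc n))\<^sup>2 * (1 - cos (x / real (Suc n)))" for n
  proof -
    define s z where "s = real (Suc n)" and "z = x / 2 * inverse s"
    have s: "s \<noteq> 0" by (simp add: s_def)
    then have "x / s = 2 * z" by (simp add: z_def field_simps)
    then have c: "cos (x / s) = 1 - 2 * (sin z)\<^sup>2" by (simp only: cos_double_sin)
    show ?thesis
      unfolding s_def[symmetric] z_def[symmetric] c using s by (simp add: power2_eq_square field_simps)
  qed
  ultimately show ?thesis by simp
qed

lemma scaled_one_minus_cos_le: "2 * s\<^sup>2 * (1 - cos (x / s)) \<le> (x::real)\<^sup>2"
proof (cases "s = 0")
  case False
  have "1 - cos (x / s) = 2 * (sin (x / (2 * s)))\<^sup>2"
    using cos_double_sin[of "x / (2 * s)"] False by (simp add: field_simps)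
  moreover have "(sin (x / (2 * s)))\<^sup>2 \<le> (x / (2 * s))\<^sup>2"
    using abs_sin_x_le_abs_x abs_le_square_iff by blast
  ultimately have "2 * s\<^sup>2 * (1 - cos (x / s)) \<le> 2 * s\<^sup>2 * (2 * (x / (2 * s))\<^sup>2)"
    by (intro mult_left_mono) auto
  also have "\<dots> = x\<^sup>2" using False by (simp add: power2_eq_square field_simps)
  finally show ?thesis .
qed simp

section \<open>Spin potentials and the height measure\<close>

definition spin_weight :: "('e \<Rightarrow> complex \<Rightarrow> real) \<Rightarrow> ('e \<Rightarrow> real) \<Rightarrow> 'e \<Rightarrow> int \<Rightarrow> real" where
  "spin_weight U \<beta> a = cos_coeff (\<lambda>t. exp (\<beta> a * - U a (cis t)))"

locale spin_graph = rooted_graph G r for G :: "('v, 'e) pre_digraph" and r +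
  fixes U :: "'e \<Rightarrow> complex \<Rightarrow> real" and c :: "'e \<Rightarrow> nat \<Rightarrow> real"
  assumes cosine_series: "a \<in> arcs G \<Longrightarrow> cosine_series (c a) (\<lambda>t. - U a (cis t))"
begin

lemma admissible_spin_weight:
  assumes "\<And>a. a \<in> arcs G \<Longrightarrow> \<beta> a \<ge> 0"
  shows "admissible (spin_weight U \<beta>)"
  unfolding admissible_def
proof (intro ballI conjI allI exI impI)
  fix a assume a: "a \<in> arcs G"
  then interpret cosine_series "c a" "\<lambda>t. - U a (cis t)" by (rule cosine_series)
  show "spin_weight U \<beta> a n \<ge> 0" for n
    unfolding spin_weight_def by (intro cos_coeff_exp_nonneg assms a)
  show "spin_weight U \<beta> a 0 > 0"
    unfolding spin_weight_def by (rule cos_coeff_exp_0_pos)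
  show "sum (spin_weight U \<beta> a) N \<le> exp (\<beta> a * suminf (c a))" if "finite N" for N
    unfolding spin_weight_def by (intro sum_cos_coeff_exp_le that assms a)
qed

lemma height_weight_eq:
  assumes "\<And>a. a \<in> arcs G \<Longrightarrow> \<beta> a \<ge> 0"
  shows "height_weight G (\<lambda>e. dual_potential (U e) (\<beta> e)) h = ennreal (weight (spin_weight U \<beta>) h)"
proof -
  have "dual_potential (U a) (\<beta> a) n = (if spin_weight U \<beta> a n = 0 then \<infinity> else ereal (- ln (spin_weight U \<beta> a n)))"
    if a: "a \<in> arcs G" for a n
  proof -
    interpret cosine_series "c a" "\<lambda>t. - U a (cis t)" by (rule cosine_series[OF a])
    have "continuous_on {0..2*pi} (\<lambda>t. exp (\<beta> a * - U a (cis t)))"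
      by (intro continuous_intros continuous_on_sum)
    then have "Re (fourier_coeff (\<lambda>z. exp (- \<beta> a * U a z)) n) = spin_weight U \<beta> a n"
      unfolding spin_weight_def by (subst Re_fourier_coeff) simp_all
    then show ?thesis by (simp add: dual_potential_def Let_def)
  qed
  then have "height_weight G (\<lambda>e. dual_potential (U e) (\<beta> e)) h = exp_ereal (- (\<Sum>a\<in>arcs G.
      if spin_weight U \<beta> a (grad G h a) = 0 then \<infinity> else ereal (- ln (spin_weight U \<beta> a (grad G h a)))))"
    unfolding height_weight_def by (intro arg_cong[where f = "\<lambda>s. exp_ereal (- s)"] sum.cong) auto
  also have "\<dots> = ennreal (weight (spin_weight U \<beta>) h)"
    unfolding weight_def using admissible_spin_weight[OF assms]
    by (intro exp_ereal_minus_sum finite_arcs) (auto simp: admissible_def)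
  finally show ?thesis .
qed

text \<open>For a bounded observable the numerator and the partition sum are both finite, so the
  extended nonnegative integral is a quotient of real sums, to which
  \<open>infsum_cos_comparison\<close> applies.\<close>

lemma nn_integral_height_measure:
  assumes \<beta>: "\<And>a. a \<in> arcs G \<Longrightarrow> \<beta> a \<ge> 0" and X: "\<And>h. 0 \<le> X h" "\<And>h. X h \<le> B"
  shows "(\<integral>\<^sup>+h. ennreal (X h) \<partial>height_measure G r U \<beta>)
    = ennreal (infsum (\<lambda>h. X h * weight (spin_weight U \<beta>) h) (heights G r)
        / infsum (weight (spin_weight U \<beta>)) (heights G r))"
proof -
  let ?W = "weight (spin_weight U \<beta>)" and ?H = "heights G r"
  define Z where "Z = partition_function G r (\<lambda>e. dual_potential (U e) (\<beta> e))"
  have adm: "admissible (spin_weight U \<beta>)" by (rule admissible_spin_weight[OF \<beta>])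
  note W0 = weight_nonneg[OF adm] and sW = weight_summable[OF adm]
  have sX: "(\<lambda>h. X h * ?W h) summable_on ?H"
  proof (rule summable_on_comparison_test)
    show "(\<lambda>h. B * ?W h) summable_on ?H" by (intro summable_on_cmult_right sW)
  qed (use X W0 in \<open>auto intro: mult_right_mono\<close>)
  have Weq: "height_weight G (\<lambda>e. dual_potential (U e) (\<beta> e)) = (\<lambda>h. ennreal (?W h))"
    by (rule ext) (rule height_weight_eq[OF \<beta>])
  have Z: "Z = ennreal (infsum ?W ?H)"
    unfolding Z_def partition_function_def Weq
    by (intro nn_integral_count_space_eq_infsum sW W0)
  have "(\<integral>\<^sup>+h. ennreal (X h) \<partial>height_measure G r U \<beta>)
      = (\<integral>\<^sup>+h. ennreal (?W h) / Z * ennreal (X h) \<partial>count_space ?H)"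
    unfolding height_measure_def Let_def Weq Z_def[symmetric]
    by (subst nn_integral_density) auto
  also have "\<dots> = (\<integral>\<^sup>+h. ennreal (X h * ?W h) / Z \<partial>count_space ?H)"
    using X(1) W0 by (intro nn_integral_cong) (simp add: ennreal_mult ennreal_times_divide mult.commute)
  also have "\<dots> = (\<integral>\<^sup>+h. ennreal (X h * ?W h) \<partial>count_space ?H) / Z"
    by (intro nn_integral_divide) simp
  also have "\<dots> = ennreal (infsum (\<lambda>h. X h * ?W h) ?H) / ennreal (infsum ?W ?H)"
    unfolding Z by (subst nn_integral_count_space_eq_infsum[OF sX]) (use X W0 in auto)
  also have "\<dots> = ennreal (infsum (\<lambda>h. X h * ?W h) ?H / infsum ?W ?H)"
    using infsum_weight_pos[OF adm] X W0 by (intro divide_ennreal infsum_nonneg) auto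
  finally show ?thesis .
qed

text \<open>The observables \<open>Y n\<close> are bounded, lie below the squared height difference
  and converge to it. Convergence with Fatou is used at \<open>\<beta>\<close>, the pointwise bound
  at \<open>\<beta>'\<close>, and the cosine comparison in between.\<close>

lemma nn_integral_square_mono:
  assumes \<beta>: "\<And>a. a \<in> arcs G \<Longrightarrow> 0 \<le> \<beta> a" and le: "\<And>a. a \<in> arcs G \<Longrightarrow> \<beta> a \<le> \<beta>' a"
    and x: "x \<in> verts G" and y: "y \<in> verts G"
  shows "(\<integral>\<^sup>+h. ennreal (of_int ((h x - h y)\<^sup>2)) \<partial>height_measure G r U \<beta>)
    \<le> (\<integral>\<^sup>+h. ennreal (of_int ((h x - h y)\<^sup>2)) \<partial>height_measure G r U \<beta>')"
proof -
  have \<beta>': "0 \<le> \<beta>' a" if "a \<in> arcs G" for a using \<beta>[OF that] le[OF that] by simp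
  define M M' where "M = height_measure G r U \<beta>" and "M' = height_measure G r U \<beta>'"
  have sets: "f \<in> borel_measurable M" "f \<in> borel_measurable M'" for f :: "('v \<Rightarrow> int) \<Rightarrow> ennreal"
    by (simp_all add: M_def M'_def height_measure_def Let_def)
  define X where "X n h = 1 - cos (of_int (h x - h y) / real (Suc n))" for n and h :: "'v \<Rightarrow> int"
  define Y where "Y n h = 2 * (real (Suc n))\<^sup>2 * X n h" for n h
  have X: "0 \<le> X n h" "X n h \<le> 2" for n h
    using cos_le_one[of "of_int (h x - h y) / real (Suc n)"] cos_ge_minus_one[of "of_int (h x - h y) / real (Suc n)"]
    unfolding X_def by linarith+
  have Xmono: "(\<integral>\<^sup>+h. ennreal (X n h) \<partial>M) \<le> (\<integral>\<^sup>+h. ennreal (X n h) \<partial>M')" for n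
  proof -
    let ?w = "spin_weight U \<beta>" and ?w' = "spin_weight U \<beta>'"
    have w: "admissible ?w" "admissible ?w'"
      by (intro admissible_spin_weight \<beta> \<beta>'; assumption)+
    have gram: "gram_kernel (parity_kernel (\<lambda>n m. ?w' a n * ?w a m))" if a: "a \<in> arcs G" for a
    proof -
      interpret cosine_series "c a" "\<lambda>t. - U a (cis t)" by (rule cosine_series[OF a])
      show ?thesis unfolding spin_weight_def by (intro gram_parity_kernel_exp \<beta> le a)
    qed
    \<comment> \<open>The comparison is stated with \<open>2 * t\<close> in the cosine, hence
      \<open>t = 1 / (2 * real (Suc n))\<close>.\<close>
    have "X n = (\<lambda>h. 1 - cos (2 * (1 / (2 * real (Suc n))) * of_int (h x - h y)))"
      by (simp add: X_def fun_eq_iff del: of_nat_Suc of_int_diff)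
    then have "infsum (\<lambda>h. X n h * weight ?w h) (heights G r) * infsum (weight ?w') (heights G r)
        \<le> infsum (\<lambda>h. X n h * weight ?w' h) (heights G r) * infsum (weight ?w) (heights G r)"
      using infsum_cos_comparison[OF w gram x y, of "1 / (2 * real (Suc n))"] by simp
    then have "infsum (\<lambda>h. X n h * weight ?w h) (heights G r) / infsum (weight ?w) (heights G r)
        \<le> infsum (\<lambda>h. X n h * weight ?w' h) (heights G r) / infsum (weight ?w') (heights G r)"
      using infsum_weight_pos[OF w(1)] infsum_weight_pos[OF w(2)] by (simp add: field_simps)
    moreover have "(\<integral>\<^sup>+h. ennreal (X n h) \<partial>height_measure G r U \<gamma>)
        = ennreal (infsum (\<lambda>h. X n h * weight (spin_weight U \<gamma>) h) (heights G r)
            / infsum (weight (spin_weight U \<gamma>)) (heights G r))"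
      if "\<And>a. a \<in> arcs G \<Longrightarrow> 0 \<le> \<gamma> a" for \<gamma>
      using that X by (rule nn_integral_height_measure)
    ultimately show ?thesis
      using \<beta> \<beta>' by (simp add: M_def M'_def ennreal_leI)
  qed
  have Y: "(\<integral>\<^sup>+h. ennreal (Y n h) \<partial>N) = ennreal (2 * (real (Suc n))\<^sup>2) * (\<integral>\<^sup>+h. ennreal (X n h) \<partial>N)"
    if "\<And>f :: ('v \<Rightarrow> int) \<Rightarrow> ennreal. f \<in> borel_measurable N" for n N
  proof -
    have "(\<integral>\<^sup>+h. ennreal (Y n h) \<partial>N) = (\<integral>\<^sup>+h. ennreal (2 * (real (Suc n))\<^sup>2) * ennreal (X n h) \<partial>N)"
      unfolding Y_def by (intro nn_integral_cong ennreal_mult X) simp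
    then show ?thesis using nn_integral_cmult[OF that] by simp
  qed
  have Ylim: "(\<lambda>n. ennreal (Y n h)) \<longlonglongrightarrow> ennreal (of_int ((h x - h y)\<^sup>2))" for h
    using tendsto_scaled_one_minus_cos[of "of_int (h x - h y)"]
    unfolding Y_def X_def by (intro tendsto_ennrealI) simp
  have Yle: "Y n h \<le> of_int ((h x - h y)\<^sup>2)" for n h
    using scaled_one_minus_cos_le[of "real (Suc n)" "of_int (h x - h y)"]
    unfolding Y_def X_def by simp
  have "(\<integral>\<^sup>+h. ennreal (of_int ((h x - h y)\<^sup>2)) \<partial>M) = (\<integral>\<^sup>+h. liminf (\<lambda>n. ennreal (Y n h)) \<partial>M)"
    by (intro nn_integral_cong) (metis lim_imp_Liminf Ylim sequentially_bot)
  also have "\<dots> \<le> liminf (\<lambda>n. \<integral>\<^sup>+h. ennreal (Y n h) \<partial>M)"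
    by (intro nn_integral_liminf sets)
  also have "\<dots> \<le> liminf (\<lambda>n. \<integral>\<^sup>+h. ennreal (of_int ((h x - h y)\<^sup>2)) \<partial>M')"
  proof (intro Liminf_mono always_eventually allI)
    fix n
    have "(\<integral>\<^sup>+h. ennreal (Y n h) \<partial>M) \<le> (\<integral>\<^sup>+h. ennreal (Y n h) \<partial>M')"
      unfolding Y[OF sets(1)] Y[OF sets(2)] by (intro mult_left_mono Xmono) simp
    also have "\<dots> \<le> (\<integral>\<^sup>+h. ennreal (of_int ((h x - h y)\<^sup>2)) \<partial>M')"
      by (intro nn_integral_mono ennreal_leI Yle)
    finally show "(\<integral>\<^sup>+h. ennreal (Y n h) \<partial>M) \<le> (\<integral>\<^sup>+h. ennreal (of_int ((h x - h y)\<^sup>2)) \<partial>M')" .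
  qed
  also have "\<dots> = (\<integral>\<^sup>+h. ennreal (of_int ((h x - h y)\<^sup>2)) \<partial>M')"
    by (simp add: Liminf_const)
  finally show ?thesis unfolding M_def M'_def .
qed

end

theorem theorem5p1:
  fixes G :: "('v, 'e) pre_digraph"
    and U :: "'e \<Rightarrow> complex \<Rightarrow> real"
    and \<beta> :: "'e \<Rightarrow> real"
    and r x y :: 'v and e :: 'e
  assumes "fin_digraph G"
    and "Digraph_Component.connected G"
    and "\<And>a. a \<in> arcs G \<Longrightarrow> C2_circle (U a)"
    and "\<And>a. a \<in> arcs G \<Longrightarrow> positive_definite (\<lambda>z. - U a z)"
    and "\<And>a. a \<in> arcs G \<Longrightarrow> \<beta> a \<ge> 0"
    and "r \<in> verts G" and "x \<in> verts G" and "y \<in> verts G" and "e \<in> arcs G"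
  shows "mono_on {0..} (\<lambda>b. \<integral>\<^sup>+ h. ennreal (of_int ((h x - h y)\<^sup>2)) \<partial>height_measure G r U (\<beta>(e := b)))"
proof -
  have "\<exists>c. cosine_series c (\<lambda>t. - U a (cis t))" if a: "a \<in> arcs G" for a
  proof -
    obtain f' f'' where "\<And>t. ((\<lambda>s. U a (cis s)) has_real_derivative f' t) (at t)"
        "\<And>t. (f' has_real_derivative f'' t) (at t)" "continuous_on UNIV f''"
      using assms(3)[OF a] unfolding C2_circle_def by blast
    then have "C2_circle (\<lambda>z. - U a z)"
      unfolding C2_circle_def
      by (intro exI[of _ "\<lambda>t. - f' t"] exI[of _ "\<lambda>t. - f'' t"] conjI allI DERIV_minus continuous_on_minus)
    then show ?thesis using cosine_series_exists[OF _ assms(4)[OF a]] by blast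
  qed
  then obtain c where "\<And>a. a \<in> arcs G \<Longrightarrow> cosine_series (c a) (\<lambda>t. - U a (cis t))"
    by metis
  then interpret spin_graph G r U c
    using assms(1,2,6)
    by (intro spin_graph.intro rooted_graph.intro rooted_graph_axioms.intro spin_graph_axioms.intro)
  \<comment> \<open>Monotonicity holds jointly in all edge parameters; here only the value at
    \<open>e\<close> is raised.\<close>
  show ?thesis
    by (intro mono_onI nn_integral_square_mono assms(7,8)) (use assms(5) in auto)
qed

end
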